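(* Let $\mathfrak{g}=\mathfrak{sl}(2,\mathbb{C})$, let $N(\Lambda_0)$ be the level $1$ generalized Verma module for $\widehat{\mathfrak{g}}$ with its natural vertex operator algebra structure, let $W^N(\Lambda_0)\subset N(\Lambda_0)$ be its principal subspace (a vertex subalgebra), and let $\pi_{\Lambda_0}:W^N(\Lambda_0)\to W(\Lambda_0)$ be the restriction of the natural surjection $N(\Lambda_0)\to L(\Lambda_0)$. Writing $(v)_V$ for the ideal of a vertex algebra $V$ generated by $v\in V$, we have $$\operatorname{Ker}\pi_{\Lambda_0}=\big(x_\alpha(-1)^2\cdot v_{\Lambda_0}^N\big)_{N(\Lambda_0)}\cap W^N(\Lambda_0)=\big(x_\alpha(-1)^2\cdot v_{\Lambda_0}^N\big)_{W^N(\Lambda_0)}.$$ In particular, the intersection with the vertex subalgebra $W^N(\Lambda_0)$ of the principal ideal of $N(\Lambda_0)$ generated by the vector $x_\alpha(-1)^2\cdot v_{\Lambda_0}^N$ coincides with the principal ideal of the vertex algebra $W^N(\Lambda_0)$ generated by the same vector.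
   Context: Let $\mathfrak{g}=\mathfrak{sl}(2,\mathbb{C})=\mathbb{C}x_{-\alpha}\oplus\mathbb{C}h\oplus\mathbb{C}x_\alpha$ with $[h,x_{\pm\alpha}]=\pm2x_{\pm\alpha}$, $[x_\alpha,x_{-\alpha}]=h$, and $\langle a,b\rangle=\operatorname{tr}(ab)$. The affine Lie algebra is $\widehat{\mathfrak{g}}=\mathfrak{g}\otimes\mathbb{C}[t,t^{-1}]\oplus\mathbb{C}\mathbf{k}$ with $\mathbf{k}$ central and $[a\otimes t^m,b\otimes t^n]=[a,b]\otimes t^{m+n}+m\langle a,b\rangle\delta_{m+n,0}\mathbf{k}$. Write $a(m)$ for $a\otimes t^m$. Put $\widehat{\mathfrak{g}}_{\ge0}=\mathfrak{g}\otimes\mathbb{C}[t]\oplus\mathbb{C}\mathbf{k}$. $L(\Lambda_0)$ is the irreducible highest weight $\widehat{\mathfrak{g}}$-module with highest weight vector $v_{\Lambda_0}$ (killed by $\mathbb{C}x_\alpha\oplus\mathfrak{g}\otimes t\mathbb{C}[t]$), on which $\mathbf{k}$ acts as $1$ and $h\cdot v_{\Lambda_0}=0$. The generalized Verma module is $N(\Lambda_0)=U(\widehat{\mathfrak{g}})\otimes_{U(\widehat{\mathfrak{g}}_{\ge0})}\mathbb{C}v_{\Lambda_0}^N$, where $\mathfrak{g}\otimes\mathbb{C}[t]$ acts by $0$ and $\mathbf{k}$ by $1$ on $\mathbb{C}v_{\Lambda_0}^N$. The natural surjection $\Pi_{\Lambda_0}:N(\Lambda_0)\to L(\Lambda_0)$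 is the $\widehat{\mathfrak{g}}$-module map with $v_{\Lambda_0}^N\mapsto v_{\Lambda_0}$. With $\bar{\mathfrak{n}}=\mathbb{C}x_\alpha\otimes\mathbb{C}[t,t^{-1}]$, the principal subspaces are $W^N(\Lambda_0)=U(\bar{\mathfrak{n}})\cdot v_{\Lambda_0}^N\subset N(\Lambda_0)$ and $W(\Lambda_0)=U(\bar{\mathfrak{n}})\cdot v_{\Lambda_0}\subset L(\Lambda_0)$; $\pi_{\Lambda_0}$ is the restriction of $\Pi_{\Lambda_0}$ to $W^N(\Lambda_0)$. $N(\Lambda_0)$ carries its standard (affine, level $1$) vertex operator algebra structure, with vacuum vector $v_{\Lambda_0}^N$, vertex operators $Y(v,x)=\sum_{m\in\mathbb{Z}}v_mx^{-m-1}$ determined by $Y(a(-1)\cdot v_{\Lambda_0}^N,x)=\sum_{m\in\mathbb{Z}}a(m)x^{-m-1}$ for $a\in\mathfrak{g}$, and the usual (Sugawara) conformal vector. $W^N(\Lambda_0)$ is a vertex subalgebra (not containing the conformal vector). An ideal of a vertex algebra $V$ is a subspace $I$ such that $v_nw\in I$ and $w_nv\in I$ for all $v\in V$, $w\in I$, $n\in\mathbb{Z}$. The ideal generated by $v$ is the smallest ideal containing $v$; an ideal generated by one element is called principal. *)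

theory Defs
  imports "HOL-Analysis.Analysis" "HOL-Library.Poly_Mapping"
begin

section \<open>Complex Lie algebras and their modules\<close>

class complex_lie_algebra = ab_group_add +
  fixes lie_scale :: "complex \<Rightarrow> 'a \<Rightarrow> 'a"
    and lie_bracket :: "'a \<Rightarrow> 'a \<Rightarrow> 'a"
  assumes lie_scale_add_right: "lie_scale c (x + y) = lie_scale c x + lie_scale c y"
    and lie_scale_add_left: "lie_scale (c + d) x = lie_scale c x + lie_scale d x"
    and lie_scale_scale: "lie_scale c (lie_scale d x) = lie_scale (c * d) x"
    and lie_scale_one: "lie_scale 1 x = x"
    and lie_bracket_add_left: "lie_bracket (x + y) z = lie_bracket x z + lie_bracket y z"
    and lie_bracket_add_right: "lie_bracket x (y + z) = lie_bracket x y + lie_bracket x z"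
    and lie_bracket_scale_left: "lie_bracket (lie_scale c x) y = lie_scale c (lie_bracket x y)"
    and lie_bracket_scale_right: "lie_bracket x (lie_scale c y) = lie_scale c (lie_bracket x y)"
    and lie_bracket_self: "lie_bracket x x = 0"
    and lie_jacobi:
      "lie_bracket x (lie_bracket y z) + lie_bracket y (lie_bracket z x)
        + lie_bracket z (lie_bracket x y) = 0"

locale lie_module = vector_space scale
  for scale :: "complex \<Rightarrow> 'v::ab_group_add \<Rightarrow> 'v" +
  fixes act :: "'g::complex_lie_algebra \<Rightarrow> 'v \<Rightarrow> 'v"
  assumes act_add_left: "act (x + y) v = act x v + act y v"
    and act_scale_left: "act (lie_scale c x) v = scale c (act x v)"
    and act_add_right: "act x (v + w) = act x v + act x w"
    and act_scale_right: "act x (scale c v) = scale c (act x v)"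
    and act_bracket: "act (lie_bracket x y) v = act x (act y v) - act y (act x v)"
begin

definition submodule :: "'v set \<Rightarrow> bool"
  where "submodule U \<longleftrightarrow> subspace U \<and> (\<forall>x. \<forall>v\<in>U. act x v \<in> U)"

definition irreducible_module :: bool
  where "irreducible_module \<longleftrightarrow>
    (\<exists>v::'v. v \<noteq> 0) \<and> (\<forall>U. submodule U \<longrightarrow> U = {0} \<or> U = UNIV)"

lemma act_zero_right [simp]: "act x 0 = 0"
  using act_add_right[of x 0 0] by simp

lemma act_minus_right: "act x (v - w) = act x v - act x w"
  using act_add_right[of x "v - w" w] by simp

lemma act_sum_right: "act x (sum f A) = (\<Sum>a\<in>A. act x (f a))"
  by (induction A rule: infinite_finite_induct) (auto simp: act_add_right)

end

definition lie_module_hom ::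
    "(complex \<Rightarrow> 'v \<Rightarrow> 'v) \<Rightarrow> ('g \<Rightarrow> 'v \<Rightarrow> 'v) \<Rightarrow> (complex \<Rightarrow> 'w \<Rightarrow> 'w) \<Rightarrow> ('g \<Rightarrow> 'w \<Rightarrow> 'w)
      \<Rightarrow> ('v::ab_group_add \<Rightarrow> 'w::ab_group_add) \<Rightarrow> bool"
  where "lie_module_hom s1 act1 s2 act2 f \<longleftrightarrow>
    Vector_Spaces.linear s1 s2 f \<and> (\<forall>x v. f (act1 x v) = act2 x (f v))"


section \<open>Formal linear combinations\<close>

abbreviation "lookup \<equiv> Poly_Mapping.lookup"
abbreviation "single \<equiv> Poly_Mapping.single"
abbreviation "keys \<equiv> Poly_Mapping.keys"

definition pm_scale :: "complex \<Rightarrow> ('k \<Rightarrow>\<^sub>0 complex) \<Rightarrow> ('k \<Rightarrow>\<^sub>0 complex)"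
  where "pm_scale c p = Poly_Mapping.map ((*) c) p"

lemma lookup_pm_scale [simp]: "lookup (pm_scale c p) k = c * lookup p k"
  by (simp add: pm_scale_def Poly_Mapping.map.rep_eq when_def)

lemma pm_expand:
  fixes p :: "'k \<Rightarrow>\<^sub>0 'c::comm_monoid_add"
  obtains A f where "finite A" "p = (\<Sum>k\<in>A. single k (f k))"
proof (rule that)
  show "p = (\<Sum>k\<in>keys p. single k (lookup p k))"
    by (rule poly_mapping_eqI) (auto simp: lookup_sum lookup_single when_def in_keys_iff)
qed simp

interpretation pm: vector_space pm_scale
  by unfold_locales (auto intro!: poly_mapping_eqI simp: lookup_add algebra_simps)

lemma pm_scale_mult_left: "pm_scale c p * q = pm_scale c (p * q)"
  for p q :: "'k::monoid_add \<Rightarrow>\<^sub>0 complex"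
  by (simp add: pm_scale_def mult_map_scale_conv_mult mult.assoc)

lemma single_0_commute: "single 0 c * p = p * single 0 c"
  for p :: "'k::monoid_add \<Rightarrow>\<^sub>0 complex"
proof -
  obtain A f where p: "p = (\<Sum>k\<in>A. single k (f k))" by (rule pm_expand)
  show ?thesis
    by (simp add: p sum_distrib_left sum_distrib_right mult_single mult.commute)
qed

lemma pm_scale_mult_right: "p * pm_scale c q = pm_scale c (p * q)"
  for p q :: "'k::monoid_add \<Rightarrow>\<^sub>0 complex"
  unfolding pm_scale_def mult_map_scale_conv_mult mult.assoc[symmetric] single_0_commute[of c p] ..

text \<open>The linear extension of a function on the basis to formal linear combinations.\<close>

definition lin_ext :: "(complex \<Rightarrow> 'v \<Rightarrow> 'v) \<Rightarrow> ('k \<Rightarrow> 'v) \<Rightarrow> ('k \<Rightarrow>\<^sub>0 complex) \<Rightarrow> 'v::ab_group_add"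
  where "lin_ext s f p = (\<Sum>k\<in>keys p. s (lookup p k) (f k))"

context vector_space
begin

lemma lin_ext_superset:
  fixes f :: "'k \<Rightarrow> 'b" and p :: "'k \<Rightarrow>\<^sub>0 'a"
  assumes "finite S" "keys p \<subseteq> S"
  shows "(\<Sum>k\<in>keys p. scale (lookup p k) (f k)) = (\<Sum>k\<in>S. scale (lookup p k) (f k))"
  using assms by (intro sum.mono_neutral_left) (auto simp: in_keys_iff)

end

lemma lin_ext_add:
  assumes "vector_space s"
  shows "lin_ext s f (p + q) = lin_ext s f p + lin_ext s f q"
proof -
  interpret vector_space s by fact
  let ?S = "keys p \<union> keys q"
  have "lin_ext s f r = (\<Sum>k\<in>?S. s (lookup r k) (f k))" if "keys r \<subseteq> ?S" for r
    using that unfolding lin_ext_def by (intro lin_ext_superset) auto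
  then show ?thesis
    using Poly_Mapping.keys_add[of p q]
    by (simp add: lookup_add scale_left_distrib sum.distrib)
qed

lemma lin_ext_pm_scale:
  assumes "vector_space s"
  shows "lin_ext s f (pm_scale c p) = s c (lin_ext s f p)"
proof -
  interpret vector_space s by fact
  have "lin_ext s f (pm_scale c p) = (\<Sum>k\<in>keys p. s (lookup (pm_scale c p) k) (f k))"
    unfolding lin_ext_def by (intro lin_ext_superset) (auto simp: in_keys_iff)
  then show ?thesis by (simp add: lin_ext_def scale_sum_right)
qed

lemma lin_ext_zero [simp]: "lin_ext s f 0 = 0"
  by (simp add: lin_ext_def)

lemma lin_ext_minus:
  assumes "vector_space s"
  shows "lin_ext s f (p - q) = lin_ext s f p - lin_ext s f q"
  using lin_ext_add[OF assms, of f "p - q" q] by simp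

lemma lin_ext_single:
  assumes "vector_space s"
  shows "lin_ext s f (single k c) = s c (f k)"
proof -
  interpret vector_space s by fact
  show ?thesis by (simp add: lin_ext_def)
qed

lemma lin_ext_linear:
  assumes "vector_space s"
  shows "Vector_Spaces.linear pm_scale s (lin_ext s f)"
proof -
  interpret vector_space s by fact
  show ?thesis
    by unfold_locales (auto simp: lin_ext_add[OF assms] lin_ext_pm_scale[OF assms])
qed


section \<open>Universal enveloping algebras\<close>

text \<open>
  The enveloping algebra is the free associative algebra on the elements of the Lie algebra,
  modulo the two-sided ideal making the canonical map linear and turning brackets into
  commutators; the first two families of relators cut the free algebra on the underlying set
  down to the tensor algebra.
\<close>

datatype 'a word = Word (letters: "'a list")

instantiation word :: (type) monoid_add
begin
definition "0 = Word []"
definition "v + w = Word (letters v @ letters w)"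
instance by standard (auto simp: zero_word_def plus_word_def)
end

type_synonym 'a free_alg = "'a word \<Rightarrow>\<^sub>0 complex"

definition letter :: "'a \<Rightarrow> 'a free_alg"
  where "letter a = single (Word [a]) 1"

definition uea_relators :: "'a::complex_lie_algebra free_alg set"
  where "uea_relators =
    {letter (a + b) - letter a - letter b | a b. True}
    \<union> {letter (lie_scale c a) - pm_scale c (letter a) | c a. True}
    \<union> {letter a * letter b - letter b * letter a - letter (lie_bracket a b) | a b. True}"

definition uea_ideal :: "'a::complex_lie_algebra free_alg set"
  where "uea_ideal = pm.span {p * r * q | p r q. r \<in> uea_relators}"

lemma uea_ideal_mult_left: "x \<in> uea_ideal \<Longrightarrow> y * x \<in> uea_ideal"
  unfolding uea_ideal_def
proof (induction x rule: pm.span_induct_alt)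
  case base
  then show ?case by (simp add: pm.span_zero)
next
  case (step c x z)
  from step(1) obtain p r q where x: "x = p * r * q" "r \<in> uea_relators" by blast
  have "y * x = (y * p) * r * q" by (simp add: x mult.assoc)
  then have "y * x \<in> pm.span {p * r * q | p r q. r \<in> uea_relators}"
    using x by (intro pm.span_base) blast
  then show ?case
    using step(2) by (simp add: distrib_left pm_scale_mult_right pm.span_add pm.span_scale)
qed

lemma uea_ideal_mult_right: "x \<in> uea_ideal \<Longrightarrow> x * y \<in> uea_ideal"
  unfolding uea_ideal_def
proof (induction x rule: pm.span_induct_alt)
  case base
  then show ?case by (simp add: pm.span_zero)
next
  case (step c x z)
  from step(1) obtain p r q where x: "x = p * r * q" "r \<in> uea_relators" by blast
  have "x * y = p * r * (q * y)" by (simp add: x mult.assoc)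
  then have "x * y \<in> pm.span {p * r * q | p r q. r \<in> uea_relators}"
    using x by (intro pm.span_base) blast
  then show ?case
    using step(2) by (simp add: distrib_right pm_scale_mult_left pm.span_add pm.span_scale)
qed

lemma uea_ideal_add: "x \<in> uea_ideal \<Longrightarrow> y \<in> uea_ideal \<Longrightarrow> x + y \<in> uea_ideal"
  unfolding uea_ideal_def by (rule pm.span_add)

lemma uea_ideal_diff: "x \<in> uea_ideal \<Longrightarrow> y \<in> uea_ideal \<Longrightarrow> x - y \<in> uea_ideal"
  unfolding uea_ideal_def by (rule pm.span_diff)

lemma uea_ideal_zero: "0 \<in> uea_ideal"
  unfolding uea_ideal_def by (rule pm.span_zero)

lemma uea_ideal_scale: "x \<in> uea_ideal \<Longrightarrow> pm_scale c x \<in> uea_ideal"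
  unfolding uea_ideal_def by (rule pm.span_scale)

lemma uea_ideal_relator: "r \<in> uea_relators \<Longrightarrow> r \<in> uea_ideal"
proof -
  assume "r \<in> uea_relators"
  then have "1 * r * 1 \<in> uea_ideal"
    unfolding uea_ideal_def by (intro pm.span_base) blast
  then show ?thesis by simp
qed

lemma lookup_mult_zero_word: "lookup (p * q) (0 :: 'a word) = lookup p 0 * lookup q 0"
  for p q :: "'a free_alg"
proof -
  have z: "v + w = 0 \<longleftrightarrow> v = 0 \<and> w = 0" for v w :: "'a word"
    by (cases v; cases w) (simp add: zero_word_def plus_word_def)
  obtain A f where p: "p = (\<Sum>k\<in>A. single k (f k))" by (rule pm_expand)
  obtain B g where q: "q = (\<Sum>k\<in>B. single k (g k))" by (rule pm_expand)
  have s: "lookup (single v c * single w d) 0 = lookup (single v c) 0 * lookup (single w d) 0"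
    for v w :: "'a word" and c d :: complex
    by (auto simp: mult_single lookup_single when_def z)
  show ?thesis
    unfolding p q sum_product lookup_sum s ..
qed

lemma one_notin_uea_ideal: "(1 :: 'a::complex_lie_algebra free_alg) \<notin> uea_ideal"
proof
  have *: "lookup x 0 = 0" if "x \<in> uea_ideal" for x :: "'a free_alg"
    using that unfolding uea_ideal_def
  proof (induction x rule: pm.span_induct_alt)
    case base
    then show ?case by simp
  next
    case (step c x y)
    then obtain p r q where x: "x = p * r * q" "r \<in> uea_relators" by blast
    have l: "lookup (letter a) 0 = 0" for a :: 'a
      by (simp add: letter_def lookup_single when_def zero_word_def)
    from x(2) have "lookup r 0 = 0"
      unfolding uea_relators_def by (auto simp: lookup_minus lookup_mult_zero_word l)
    then have "lookup x 0 = 0" by (simp add: x lookup_mult_zero_word)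
    then show ?case using step by (simp add: lookup_add)
  qed
  assume "(1 :: 'a free_alg) \<in> uea_ideal"
  from *[OF this] show False by simp
qed

quotient_type (overloaded) 'a uea = "'a::complex_lie_algebra free_alg" / "\<lambda>p q. p - q \<in> uea_ideal"
proof (rule equivpI)
  show "reflp (\<lambda>p q :: 'a free_alg. p - q \<in> uea_ideal)"
    by (auto intro!: reflpI simp: uea_ideal_zero)
  show "symp (\<lambda>p q :: 'a free_alg. p - q \<in> uea_ideal)"
  proof (rule sympI)
    fix p q :: "'a free_alg"
    assume "p - q \<in> uea_ideal"
    from uea_ideal_diff[OF uea_ideal_zero this] show "q - p \<in> uea_ideal" by simp
  qed
  show "transp (\<lambda>p q :: 'a free_alg. p - q \<in> uea_ideal)"
  proof (rule transpI)
    fix p q r :: "'a free_alg"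
    assume "p - q \<in> uea_ideal" "q - r \<in> uea_ideal"
    from uea_ideal_add[OF this] show "p - r \<in> uea_ideal" by simp
  qed
qed

lemma uea_cases:
  fixes u :: "'a::complex_lie_algebra uea"
  obtains p where "u = abs_uea p"
  by (rule that[of "rep_uea u"]) (simp add: Quotient3_abs_rep[OF Quotient3_uea])

instantiation uea :: (complex_lie_algebra) ring_1
begin

lift_definition zero_uea :: "'a uea" is 0 .
lift_definition one_uea :: "'a uea" is 1 .
lift_definition plus_uea :: "'a uea \<Rightarrow> 'a uea \<Rightarrow> 'a uea" is "(+)"
proof -
  fix a b c d :: "'a free_alg"
  assume "a - b \<in> uea_ideal" "c - d \<in> uea_ideal"
  from uea_ideal_add[OF this] show "a + c - (b + d) \<in> uea_ideal" by (simp add: algebra_simps)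
qed
lift_definition minus_uea :: "'a uea \<Rightarrow> 'a uea \<Rightarrow> 'a uea" is "(-)"
proof -
  fix a b c d :: "'a free_alg"
  assume "a - b \<in> uea_ideal" "c - d \<in> uea_ideal"
  from uea_ideal_diff[OF this] show "a - c - (b - d) \<in> uea_ideal" by (simp add: algebra_simps)
qed
lift_definition uminus_uea :: "'a uea \<Rightarrow> 'a uea" is uminus
proof -
  fix a b :: "'a free_alg"
  assume "a - b \<in> uea_ideal"
  from uea_ideal_diff[OF uea_ideal_zero this] show "- a - - b \<in> uea_ideal" by simp
qed
lift_definition times_uea :: "'a uea \<Rightarrow> 'a uea \<Rightarrow> 'a uea" is "(*)"
proof -
  fix a b c d :: "'a free_alg"
  assume "a - b \<in> uea_ideal" "c - d \<in> uea_ideal"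
  then have "(a - b) * c + b * (c - d) \<in> uea_ideal"
    by (intro uea_ideal_add uea_ideal_mult_left uea_ideal_mult_right)
  then show "a * c - b * d \<in> uea_ideal" by (simp add: algebra_simps)
qed

instance
proof
  show "(0 :: 'a uea) \<noteq> 1"
  proof transfer
    show "\<not> (0 :: 'a free_alg) - 1 \<in> uea_ideal"
    proof
      assume "(0 :: 'a free_alg) - 1 \<in> uea_ideal"
      from uea_ideal_diff[OF uea_ideal_zero this] show False
        using one_notin_uea_ideal[where ?'a = 'a] by simp
    qed
  qed
next
  fix a b c :: "'a uea"
  show "a + b + c = a + (b + c)" "a + b = b + a" "0 + a = a" "a * b * c = a * (b * c)"
    "1 * a = a" "a * 1 = a"
    by (transfer, simp add: add.assoc add.commute mult.assoc uea_ideal_zero)+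
  show "- a + a = 0" "a - b = a + - b"
    by (transfer, simp add: uea_ideal_zero)+
  show "(a + b) * c = a * c + b * c" "a * (b + c) = a * b + a * c"
    by (transfer, simp add: distrib_left distrib_right uea_ideal_zero)+
qed

end

lift_definition uea_scale :: "complex \<Rightarrow> 'a uea \<Rightarrow> 'a::complex_lie_algebra uea" is pm_scale
  by (simp add: uea_ideal_scale flip: pm.scale_right_diff_distrib)

lift_definition uea_incl :: "'a \<Rightarrow> 'a::complex_lie_algebra uea" is letter .

text \<open>
  The action of the enveloping algebra on a module, obtained from any representative in the
  free algebra.
\<close>

definition free_act ::
    "(complex \<Rightarrow> 'v \<Rightarrow> 'v) \<Rightarrow> ('g \<Rightarrow> 'v \<Rightarrow> 'v) \<Rightarrow> 'g free_alg \<Rightarrow> 'v \<Rightarrow> 'v::ab_group_add"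
  where "free_act s act p v = lin_ext s (\<lambda>w. foldr act (letters w) v) p"

definition uea_act ::
    "(complex \<Rightarrow> 'v \<Rightarrow> 'v) \<Rightarrow> ('g \<Rightarrow> 'v \<Rightarrow> 'v) \<Rightarrow> 'g::complex_lie_algebra uea \<Rightarrow> 'v \<Rightarrow> 'v::ab_group_add"
  where "uea_act s act u v = free_act s act (rep_uea u) v"

context lie_module
begin

lemma vs: "vector_space scale" ..

lemma free_act_add: "free_act scale act (p + q) v = free_act scale act p v + free_act scale act q v"
  by (simp add: free_act_def lin_ext_add[OF vs])

lemma free_act_diff: "free_act scale act (p - q) v = free_act scale act p v - free_act scale act q v"
  by (simp add: free_act_def lin_ext_minus[OF vs])

lemma free_act_scale: "free_act scale act (pm_scale c p) v = scale c (free_act scale act p v)"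
  by (simp add: free_act_def lin_ext_pm_scale[OF vs])

lemma free_act_single: "free_act scale act (single w c) v = scale c (foldr act (letters w) v)"
  by (simp add: free_act_def lin_ext_single[OF vs])

lemma free_act_letter: "free_act scale act (letter a) v = act a v"
  by (simp add: letter_def free_act_single)

lemma free_act_one: "free_act scale act 1 v = v"
proof -
  have "free_act scale act (single 0 1) v = v"
    by (simp only: free_act_single zero_word_def word.sel foldr_Nil id_apply scale_one)
  then show ?thesis by simp
qed

lemma foldr_act_add: "foldr act xs (v + w) = foldr act xs v + foldr act xs w"
  by (induction xs) (auto simp: act_add_right)

lemma foldr_act_scale: "foldr act xs (scale c v) = scale c (foldr act xs v)"
  by (induction xs) (auto simp: act_scale_right)

lemma foldr_act_zero: "foldr act xs 0 = 0"
  by (induction xs) auto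

lemma free_act_zero_right: "free_act scale act p 0 = 0"
  by (simp add: free_act_def lin_ext_def foldr_act_zero)

lemma foldr_act_sum: "foldr act xs (sum f A) = (\<Sum>a\<in>A. foldr act xs (f a))"
  by (induction A rule: infinite_finite_induct) (auto simp: foldr_act_add foldr_act_zero)

lemma free_act_sum_left: "free_act scale act (sum f A) v = (\<Sum>a\<in>A. free_act scale act (f a) v)"
  by (induction A rule: infinite_finite_induct)
     (auto simp: free_act_add, auto simp: free_act_def)

lemma free_act_mult:
  "free_act scale act (p * q) v = free_act scale act p (free_act scale act q v)"
proof -
  obtain A f where pf: "p = (\<Sum>k\<in>A. single k (f k))" by (rule pm_expand)
  obtain B g where qg: "q = (\<Sum>k\<in>B. single k (g k))" by (rule pm_expand)
  show ?thesis
    unfolding pf qg sum_product free_act_sum_left mult_single free_act_single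
    by (simp add: plus_word_def foldr_act_sum foldr_act_scale scale_sum_right)
qed

lemma free_act_ideal: "p \<in> uea_ideal \<Longrightarrow> free_act scale act p v = 0"
  unfolding uea_ideal_def
proof (induction p rule: pm.span_induct_alt)
  case base
  then show ?case by (simp add: free_act_def)
next
  case (step c x y)
  then obtain p r q where x: "x = p * r * q" "r \<in> uea_relators" by blast
  have "free_act scale act r w = 0" for w
    using x(2) unfolding uea_relators_def
    by (auto simp: free_act_diff free_act_letter free_act_scale free_act_mult
        act_add_left act_scale_left act_bracket)
  then have "free_act scale act x v = 0"
    by (simp add: x free_act_mult free_act_zero_right)
  then show ?case using step by (simp add: free_act_add free_act_scale)
qed

lemma uea_act_abs: "uea_act scale act (abs_uea p) v = free_act scale act p v"
proof -
  have "rep_uea (abs_uea p) - p \<in> uea_ideal"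
    by (rule rep_abs_rsp_left[OF Quotient3_uea]) (simp add: uea_ideal_zero)
  from free_act_ideal[OF this] show ?thesis
    by (simp add: uea_act_def free_act_diff)
qed

lemma uea_act_incl: "uea_act scale act (uea_incl a) v = act a v"
  by (simp add: uea_incl.abs_eq uea_act_abs free_act_letter)

lemma uea_act_one: "uea_act scale act 1 v = v"
  by (simp add: one_uea.abs_eq uea_act_abs free_act_one)

lemma uea_act_mult: "uea_act scale act (a * b) v = uea_act scale act a (uea_act scale act b v)"
proof -
  obtain p q where "a = abs_uea p" "b = abs_uea q"
    by (rule uea_cases[of a], rule uea_cases[of b])
  then show ?thesis by (simp add: times_uea.abs_eq uea_act_abs free_act_mult)
qed

lemma uea_act_add: "uea_act scale act (a + b) v = uea_act scale act a v + uea_act scale act b v"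
proof -
  obtain p q where "a = abs_uea p" "b = abs_uea q"
    by (rule uea_cases[of a], rule uea_cases[of b])
  then show ?thesis by (simp add: plus_uea.abs_eq uea_act_abs free_act_add)
qed

lemma uea_act_scale: "uea_act scale act (uea_scale c a) v = scale c (uea_act scale act a v)"
proof -
  obtain p where "a = abs_uea p"
    by (rule uea_cases)
  then show ?thesis by (simp add: uea_scale.abs_eq uea_act_abs free_act_scale)
qed

end


section \<open>The Lie algebra sl(2,C) and its affinization\<close>

typedef sl2 = "{A :: complex^2^2. trace A = 0}"
  by (rule exI[of _ 0]) (simp add: trace_def)

setup_lifting type_definition_sl2

lemmas mat2_simps = vec_eq_iff forall_2 sum_2 trace_def matrix_matrix_mult_def

instantiation sl2 :: complex_lie_algebra
begin

lift_definition zero_sl2 :: sl2 is 0 by (simp add: trace_def)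
lift_definition plus_sl2 :: "sl2 \<Rightarrow> sl2 \<Rightarrow> sl2" is "(+)" by (simp add: trace_add)
lift_definition minus_sl2 :: "sl2 \<Rightarrow> sl2 \<Rightarrow> sl2" is "(-)" by (simp add: trace_sub)
lift_definition uminus_sl2 :: "sl2 \<Rightarrow> sl2" is uminus by (simp add: trace_def sum_negf)
lift_definition lie_scale_sl2 :: "complex \<Rightarrow> sl2 \<Rightarrow> sl2" is "\<lambda>c A. \<chi> i j. c * A $ i $ j"
  by (simp add: trace_def sum_2 flip: distrib_left)
lift_definition lie_bracket_sl2 :: "sl2 \<Rightarrow> sl2 \<Rightarrow> sl2" is "\<lambda>A B. A ** B - B ** A"
proof -
  fix A B :: "complex^2^2"
  show "trace (A ** B - B ** A) = 0"
    using trace_mul_sym[of A B] by (simp add: trace_sub)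
qed

instance
proof
  fix x y z :: sl2 and c d :: complex
  show "x + y + z = x + (y + z)" "x + y = y + x" "0 + x = x" "- x + x = 0" "x - y = x + - y"
    by (transfer, simp add: add.assoc add.commute)+
  show "lie_scale c (x + y) = lie_scale c x + lie_scale c y"
    "lie_scale (c + d) x = lie_scale c x + lie_scale d x"
    "lie_scale c (lie_scale d x) = lie_scale (c * d) x" "lie_scale 1 x = x"
    by (transfer, simp add: vec_eq_iff algebra_simps)+
  show "lie_bracket x x = 0"
    by transfer simp
  have matrix_sub: "(A - B) ** C = A ** C - B ** C" "C ** (A - B) = C ** A - C ** B"
    for A B C :: "complex^2^2"
    by (simp_all add: vec_eq_iff matrix_matrix_mult_def sum_2 algebra_simps)
  show "lie_bracket (x + y) z = lie_bracket x z + lie_bracket y z"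
    "lie_bracket x (y + z) = lie_bracket x y + lie_bracket x z"
    by (transfer, simp add: vec_eq_iff matrix_matrix_mult_def sum_2 algebra_simps)+
  show "lie_bracket (lie_scale c x) y = lie_scale c (lie_bracket x y)"
    "lie_bracket x (lie_scale c y) = lie_scale c (lie_bracket x y)"
    by (transfer, simp add: vec_eq_iff matrix_matrix_mult_def sum_2 algebra_simps)+
  show "lie_bracket x (lie_bracket y z) + lie_bracket y (lie_bracket z x)
      + lie_bracket z (lie_bracket x y) = 0"
    by transfer (simp add: matrix_sub matrix_mul_assoc)
qed

end

lift_definition trace_form :: "sl2 \<Rightarrow> sl2 \<Rightarrow> complex" is "\<lambda>A B. trace (A ** B)" .

lift_definition x_alpha :: sl2 is "vector [vector [0, 1], vector [0, 0]]"
  by (simp add: trace_def sum_2)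
lift_definition x_minus_alpha :: sl2 is "vector [vector [0, 0], vector [1, 0]]"
  by (simp add: trace_def sum_2)
lift_definition h_elt :: sl2 is "vector [vector [1, 0], vector [0, -1]]"
  by (simp add: trace_def sum_2)

lemma sl2_relations:
  "lie_bracket h_elt x_alpha = lie_scale 2 x_alpha"
  "lie_bracket h_elt x_minus_alpha = lie_scale (- 2) x_minus_alpha"
  "lie_bracket x_alpha x_minus_alpha = h_elt"
  by (transfer, simp (no_asm) add: mat2_simps)+

lemma sl2_span:
  "\<exists>c d e. a = lie_scale c x_minus_alpha + lie_scale d h_elt + lie_scale e x_alpha"
proof (intro exI)
  have "Rep_sl2 a $ 2 $ 2 = - (Rep_sl2 a $ 1 $ 1)"
    using Rep_sl2[of a] by (simp add: trace_def sum_2 add_eq_0_iff)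
  then show "a = lie_scale (Rep_sl2 a $ 2 $ 1) x_minus_alpha + lie_scale (Rep_sl2 a $ 1 $ 1) h_elt
      + lie_scale (Rep_sl2 a $ 1 $ 2) x_alpha"
    by (simp add: plus_sl2.rep_eq lie_scale_sl2.rep_eq x_alpha.rep_eq x_minus_alpha.rep_eq
        h_elt.rep_eq vec_eq_iff forall_2 flip: Rep_sl2_inject)
qed

lemma trace_form_simps:
  "trace_form (a + b) c = trace_form a c + trace_form b c"
  "trace_form c (a + b) = trace_form c a + trace_form c b"
  "trace_form (lie_scale z a) c = z * trace_form a c"
  "trace_form a (lie_scale z c) = z * trace_form a c"
  by (transfer, simp (no_asm) add: mat2_simps algebra_simps)+

lemma trace_form_zero [simp]: "trace_form 0 c = 0" "trace_form c 0 = 0"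
  by (transfer, simp (no_asm) add: mat2_simps)+

lemma trace_form_sym: "trace_form a b = trace_form b a"
  by transfer (rule trace_mul_sym)

lemma trace_form_invariant: "trace_form (lie_bracket a b) c = trace_form a (lie_bracket b c)"
  by (transfer, simp (no_asm) add: mat2_simps algebra_simps)

lemma lie_bracket_zero [simp]: "lie_bracket 0 (y::'a::complex_lie_algebra) = 0" "lie_bracket y (0::'a) = 0"
  using lie_bracket_add_left[of 0 0 y] lie_bracket_add_right[of y 0 0] by simp_all

lemma lie_scale_zero [simp]: "lie_scale c (0::'a::complex_lie_algebra) = 0" "lie_scale 0 (x::'a) = 0"
  using lie_scale_add_right[of c 0 "0::'a"] lie_scale_add_left[of 0 0 x] by simp_all

text \<open>
  An element of the loop algebra is a finitely supported function from the integers to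
  sl(2,C), giving the coefficient of each power of t.
\<close>

datatype affine = Affine (loop_part: "int \<Rightarrow>\<^sub>0 sl2") (central_part: complex)

definition mode :: "sl2 \<Rightarrow> int \<Rightarrow> affine"
  where "mode a m = Affine (single m a) 0"

definition central :: affine
  where "central = Affine 0 1"

definition mode_bracket :: "sl2 \<Rightarrow> int \<Rightarrow> sl2 \<Rightarrow> int \<Rightarrow> affine"
  where "mode_bracket a m b n =
    Affine (single (m + n) (lie_bracket a b)) (if m + n = 0 then of_int m * trace_form a b else 0)"

instantiation affine :: ab_group_add
begin
definition "0 = Affine 0 0"
definition "X + Y = Affine (loop_part X + loop_part Y) (central_part X + central_part Y)"
definition "X - Y = Affine (loop_part X - loop_part Y) (central_part X - central_part Y)"
definition "- X = Affine (- loop_part X) (- central_part X)"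
instance
  by standard
    (auto simp: zero_affine_def plus_affine_def minus_affine_def uminus_affine_def algebra_simps)
end

lemma affine_sel_simps [simp]:
  "loop_part 0 = 0" "central_part 0 = 0"
  "loop_part (X + Y) = loop_part X + loop_part Y"
  "central_part (X + Y) = central_part X + central_part Y"
  "loop_part (X - Y) = loop_part X - loop_part Y"
  "central_part (X - Y) = central_part X - central_part Y"
  "loop_part (- X) = - loop_part X"
  "central_part (- X) = - central_part X"
  by (auto simp: zero_affine_def plus_affine_def minus_affine_def uminus_affine_def)

lemma affine_sel_sum [simp]:
  "loop_part (sum f A) = (\<Sum>a\<in>A. loop_part (f a))"
  "central_part (sum f A) = (\<Sum>a\<in>A. central_part (f a))"
  by (induction A rule: infinite_finite_induct) auto

definition affine_scale :: "complex \<Rightarrow> affine \<Rightarrow> affine"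
  where "affine_scale c X = Affine (Poly_Mapping.map (lie_scale c) (loop_part X)) (c * central_part X)"

definition affine_bracket :: "affine \<Rightarrow> affine \<Rightarrow> affine"
  where "affine_bracket X Y =
    (\<Sum>m\<in>keys (loop_part X). \<Sum>n\<in>keys (loop_part Y).
       mode_bracket (lookup (loop_part X) m) m (lookup (loop_part Y) n) n)"

lemma lookup_map_lie_scale [simp]:
  "lookup (Poly_Mapping.map (lie_scale c) p) k = lie_scale c (lookup p k)"
  by (simp add: Poly_Mapping.map.rep_eq when_def)

lemma mode_bracket_zero [simp]: "mode_bracket 0 m b n = 0" "mode_bracket a m 0 n = 0"
  by (simp_all add: mode_bracket_def zero_affine_def)

lemma mode_bracket_add:
  "mode_bracket (a + a') m b n = mode_bracket a m b n + mode_bracket a' m b n"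
  "mode_bracket a m (b + b') n = mode_bracket a m b n + mode_bracket a m b' n"
  by (auto simp: mode_bracket_def plus_affine_def lie_bracket_add_left lie_bracket_add_right
      single_add trace_form_simps algebra_simps)

lemma map_lie_scale_single:
  "Poly_Mapping.map (lie_scale c) (single k a) = single k (lie_scale c a)"
  by (rule poly_mapping_eqI) (simp add: lookup_single when_def)

lemma mode_bracket_scale:
  "mode_bracket (lie_scale c a) m b n = affine_scale c (mode_bracket a m b n)"
  "mode_bracket a m (lie_scale c b) n = affine_scale c (mode_bracket a m b n)"
  by (auto simp: mode_bracket_def affine_scale_def lie_bracket_scale_left lie_bracket_scale_right
      map_lie_scale_single trace_form_simps algebra_simps)

lemma affine_scale_add_right: "affine_scale c (X + Y) = affine_scale c X + affine_scale c Y"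
  by (rule affine.expand)
     (auto simp: affine_scale_def lookup_add lie_scale_add_right algebra_simps intro!: poly_mapping_eqI)

lemma affine_scale_zero: "affine_scale c 0 = 0"
  using affine_scale_add_right[of c 0 0] by simp

lemma affine_scale_sum: "affine_scale c (sum f A) = (\<Sum>a\<in>A. affine_scale c (f a))"
  by (induction A rule: infinite_finite_induct) (auto simp: affine_scale_add_right affine_scale_zero)

lemma affine_bracket_superset:
  assumes "finite S" "finite T" "keys (loop_part X) \<subseteq> S" "keys (loop_part Y) \<subseteq> T"
  shows "affine_bracket X Y =
    (\<Sum>m\<in>S. \<Sum>n\<in>T. mode_bracket (lookup (loop_part X) m) m (lookup (loop_part Y) n) n)"
proof -
  have "affine_bracket X Y = (\<Sum>m\<in>keys (loop_part X). \<Sum>n\<in>T.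
      mode_bracket (lookup (loop_part X) m) m (lookup (loop_part Y) n) n)"
    unfolding affine_bracket_def using assms
    by (intro sum.cong refl sum.mono_neutral_left) (auto simp: in_keys_iff)
  also have "\<dots> = (\<Sum>m\<in>S. \<Sum>n\<in>T. mode_bracket (lookup (loop_part X) m) m (lookup (loop_part Y) n) n)"
    using assms by (intro sum.mono_neutral_left) (auto simp: in_keys_iff)
  finally show ?thesis .
qed

lemma affine_bracket_add_left:
  "affine_bracket (X + Y) Z = affine_bracket X Z + affine_bracket Y Z"
proof -
  let ?S = "keys (loop_part X) \<union> keys (loop_part Y)" and ?T = "keys (loop_part Z)"
  have *: "affine_bracket W Z =
      (\<Sum>m\<in>?S. \<Sum>n\<in>?T. mode_bracket (lookup (loop_part W) m) m (lookup (loop_part Z) n) n)"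
    if "keys (loop_part W) \<subseteq> ?S" for W
    by (rule affine_bracket_superset) (use that in auto)
  have "keys (loop_part (X + Y)) \<subseteq> ?S"
    by (simp add: Poly_Mapping.keys_add)
  from *[OF this] show ?thesis
    by (simp add: *[of X] *[of Y] lookup_add mode_bracket_add sum.distrib)
qed

lemma affine_bracket_add_right:
  "affine_bracket Z (X + Y) = affine_bracket Z X + affine_bracket Z Y"
proof -
  let ?S = "keys (loop_part X) \<union> keys (loop_part Y)" and ?T = "keys (loop_part Z)"
  have *: "affine_bracket Z W =
      (\<Sum>m\<in>?T. \<Sum>n\<in>?S. mode_bracket (lookup (loop_part Z) m) m (lookup (loop_part W) n) n)"
    if "keys (loop_part W) \<subseteq> ?S" for W
    by (rule affine_bracket_superset) (use that in auto)
  have "keys (loop_part (X + Y)) \<subseteq> ?S"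
    by (simp add: Poly_Mapping.keys_add)
  from *[OF this] show ?thesis
    by (simp add: *[of X] *[of Y] lookup_add mode_bracket_add sum.distrib)
qed

lemma affine_bracket_scale_left: "affine_bracket (affine_scale c X) Y = affine_scale c (affine_bracket X Y)"
proof -
  have "affine_bracket (affine_scale c X) Y = (\<Sum>m\<in>keys (loop_part X). \<Sum>n\<in>keys (loop_part Y).
      mode_bracket (lookup (loop_part (affine_scale c X)) m) m (lookup (loop_part Y) n) n)"
    by (rule affine_bracket_superset) (auto simp: affine_scale_def in_keys_iff)
  then show ?thesis
    by (simp add: affine_bracket_def affine_scale_sum affine_scale_def[of c X] mode_bracket_scale)
qed

lemma affine_bracket_scale_right: "affine_bracket X (affine_scale c Y) = affine_scale c (affine_bracket X Y)"
proof -
  have "affine_bracket X (affine_scale c Y) = (\<Sum>m\<in>keys (loop_part X). \<Sum>n\<in>keys (loop_part Y).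
      mode_bracket (lookup (loop_part X) m) m (lookup (loop_part (affine_scale c Y)) n) n)"
    by (rule affine_bracket_superset) (auto simp: affine_scale_def in_keys_iff)
  then show ?thesis
    by (simp add: affine_bracket_def affine_scale_sum affine_scale_def[of c Y] mode_bracket_scale)
qed

lemma affine_bracket_mode: "affine_bracket (mode a m) (mode b n) = mode_bracket a m b n"
  by (simp add: affine_bracket_superset[of "{m}" "{n}"] mode_def)

lemma affine_bracket_central [simp]:
  "affine_bracket (Affine 0 c) X = 0" "affine_bracket X (Affine 0 c) = 0"
  by (simp_all add: affine_bracket_def)

lemma affine_bracket_zero [simp]: "affine_bracket 0 X = 0" "affine_bracket X 0 = 0"
  by (simp_all add: affine_bracket_def)

lemma affine_induct [case_names central mode add]:
  assumes c: "\<And>c. P (Affine 0 c)" and m: "\<And>a m. P (mode a m)"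
    and a: "\<And>X Y. P X \<Longrightarrow> P Y \<Longrightarrow> P (X + Y)"
  shows "P X"
proof -
  obtain A f where f: "finite A" "loop_part X = (\<Sum>k\<in>A. single k (f k))" by (rule pm_expand)
  have "P (\<Sum>k\<in>A. mode (f k) k)"
    using f(1) by (induction A) (auto intro: a m c[of 0, folded zero_affine_def])
  moreover have "X = Affine 0 (central_part X) + (\<Sum>k\<in>A. mode (f k) k)"
    by (rule affine.expand) (simp add: f mode_def)
  ultimately show ?thesis using a[OF c] by metis
qed

lemma lie_bracket_skew: "lie_bracket a b = - lie_bracket b a"
  for a :: "'a::complex_lie_algebra"
proof -
  have "lie_bracket (a + b) (a + b) = lie_bracket a b + lie_bracket b a"
    unfolding lie_bracket_add_left lie_bracket_add_right by (simp add: lie_bracket_self)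
  then have "lie_bracket a b + lie_bracket b a = 0"
    by (simp add: lie_bracket_self)
  then show ?thesis by (simp add: eq_neg_iff_add_eq_0)
qed

lemma affine_bracket_skew: "affine_bracket X Y + affine_bracket Y X = 0"
proof (induction X rule: affine_induct)
  case (mode a m)
  show ?case
  proof (induction Y rule: affine_induct)
    case (mode b n)
    have "lie_bracket b a = - lie_bracket a b" by (rule lie_bracket_skew)
    moreover have "of_int n = (- of_int m :: complex)" if "m + n = 0"
      using that by (metis add.commute eq_neg_iff_add_eq_0 of_int_minus)
    ultimately show ?case
      by (auto simp: affine_bracket_mode mode_bracket_def plus_affine_def zero_affine_def
          add.commute trace_form_sym[of b a] simp flip: single_add)
  next
    case (add X Y)
    then show ?case by (simp add: affine_bracket_add_left affine_bracket_add_right algebra_simps)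
  qed simp
next
  case (add X1 X2)
  then show ?case by (simp add: affine_bracket_add_left affine_bracket_add_right algebra_simps)
qed simp

lemma affine_jacobi_modes:
  "affine_bracket (mode a m) (affine_bracket (mode b n) (mode c p))
    + affine_bracket (mode b n) (affine_bracket (mode c p) (mode a m))
    + affine_bracket (mode c p) (affine_bracket (mode a m) (mode b n)) = 0"
proof -
  have split: "mode_bracket a m b n = mode (lie_bracket a b) (m + n)
      + Affine 0 (if m + n = 0 then of_int m * trace_form a b else 0)" for a b m n
    by (simp add: mode_bracket_def mode_def plus_affine_def)
  have *: "affine_bracket (mode a m) (affine_bracket (mode b n) (mode c p)) =
      Affine (single (m + n + p) (lie_bracket a (lie_bracket b c)))
        (if m + n + p = 0 then of_int m * trace_form a (lie_bracket b c) else 0)" for a m b n c p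
    by (simp add: affine_bracket_mode split[of b n] affine_bracket_add_right)
       (simp add: mode_bracket_def algebra_simps)
  have t: "trace_form b (lie_bracket c a) = trace_form a (lie_bracket b c)"
    "trace_form c (lie_bracket a b) = trace_form a (lie_bracket b c)"
    by (metis trace_form_invariant trace_form_sym)+
  have z: "of_int m * x + of_int n * x + of_int p * x = (0::complex)" if "m + n + p = 0" for x
    using that by (metis distrib_right mult_zero_left of_int_0 of_int_add)
  have e: "n + p + m = m + n + p" "p + m + n = m + n + p" by auto
  show ?thesis
    unfolding * t e
    by (simp add: plus_affine_def zero_affine_def z lie_jacobi flip: single_add)
qed

instantiation affine :: complex_lie_algebra
begin
definition "lie_scale = affine_scale"
definition "lie_bracket = affine_bracket"
instance
proof
  fix X Y Z :: affine and c d :: complex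
  show "lie_scale c (X + Y) = lie_scale c X + lie_scale c Y"
    by (simp add: lie_scale_affine_def affine_scale_add_right)
  show "lie_scale (c + d) X = lie_scale c X + lie_scale d X"
    unfolding lie_scale_affine_def
    by (rule affine.expand)
       (auto simp: affine_scale_def lookup_add lie_scale_add_left algebra_simps intro!: poly_mapping_eqI)
  show "lie_scale c (lie_scale d X) = lie_scale (c * d) X"
    unfolding lie_scale_affine_def
    by (rule affine.expand)
       (auto simp: affine_scale_def lie_scale_scale algebra_simps intro!: poly_mapping_eqI)
  show "lie_scale 1 X = X"
    unfolding lie_scale_affine_def
    by (rule affine.expand) (auto simp: affine_scale_def lie_scale_one intro!: poly_mapping_eqI)
  show "lie_bracket (X + Y) Z = lie_bracket X Z + lie_bracket Y Z"
    by (simp add: lie_bracket_affine_def affine_bracket_add_left)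
  show "lie_bracket X (Y + Z) = lie_bracket X Y + lie_bracket X Z"
    by (simp add: lie_bracket_affine_def affine_bracket_add_right)
  show "lie_bracket (lie_scale c X) Y = lie_scale c (lie_bracket X Y)"
    by (simp add: lie_bracket_affine_def lie_scale_affine_def affine_bracket_scale_left)
  show "lie_bracket X (lie_scale c Y) = lie_scale c (lie_bracket X Y)"
    by (simp add: lie_bracket_affine_def lie_scale_affine_def affine_bracket_scale_right)
  show "lie_bracket X X = 0"
  proof -
    have "2 * central_part (affine_bracket X X) = 0"
      using affine_bracket_skew[of X X] arg_cong[of _ _ central_part]
      by (metis affine_sel_simps(2,4) mult_2)
    moreover have "lookup (loop_part (affine_bracket X X)) k = 0" for k
    proof -
      let ?a = "lookup (loop_part (affine_bracket X X)) k"
      have "?a + ?a = 0"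
        using affine_bracket_skew[of X X]
        by (metis affine_sel_simps(1,3) lookup_add lookup_zero)
      then have "lie_scale 2 ?a = 0"
        using lie_scale_add_left[of 1 1 ?a] by (simp add: lie_scale_one)
      then have "lie_scale (1/2) (lie_scale 2 ?a) = 0" by simp
      then show ?thesis by (simp add: lie_scale_scale lie_scale_one)
    qed
    ultimately show ?thesis
      unfolding lie_bracket_affine_def
      by (intro affine.expand) (auto intro: poly_mapping_eqI)
  qed
  have "affine_bracket X (affine_bracket Y Z) + affine_bracket Y (affine_bracket Z X)
      + affine_bracket Z (affine_bracket X Y) = 0"
  proof (induction X rule: affine_induct)
    case (mode a m)
    show ?case
    proof (induction Y rule: affine_induct)
      case (mode b n)
      show ?case
      proof (induction Z rule: affine_induct)
        case (mode c p)
        show ?case by (rule affine_jacobi_modes)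
      next
        case (add X Y)
        then show ?case
          by (simp add: affine_bracket_add_left affine_bracket_add_right add_eq_0_iff)
      qed (simp flip: zero_affine_def)
    next
      case (add X Y)
      then show ?case
        by (simp add: affine_bracket_add_left affine_bracket_add_right add_eq_0_iff)
    qed (simp flip: zero_affine_def)
  next
    case (add X Y)
    then show ?case
      by (simp add: affine_bracket_add_left affine_bracket_add_right add_eq_0_iff)
  qed (simp flip: zero_affine_def)
  then show "lie_bracket X (lie_bracket Y Z) + lie_bracket Y (lie_bracket Z X)
      + lie_bracket Z (lie_bracket X Y) = 0"
    by (simp add: lie_bracket_affine_def)
qed
end


text \<open>The subalgebras spanned by the loops polynomial in t and the centre, and by the loops with values
  in the line through \<open>x_alpha\<close>.\<close>

typedef affine_ge0 = "{X. \<forall>m\<in>keys (loop_part X). m \<ge> 0}"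
  by (rule exI[of _ 0]) simp

setup_lifting type_definition_affine_ge0

typedef nbar = "{X. central_part X = 0 \<and> (\<forall>m. \<exists>c. lookup (loop_part X) m = lie_scale c x_alpha)}"
  by (rule exI[of _ 0]) (auto intro!: exI[of _ 0])

setup_lifting type_definition_nbar

lemma lie_scale_ge0_closed:
  assumes "\<forall>m\<in>keys (loop_part X). m \<ge> 0"
  shows "\<forall>m\<in>keys (loop_part (lie_scale c X)). m \<ge> 0"
proof
  fix m
  assume "m \<in> keys (loop_part (lie_scale c X))"
  then have "lookup (loop_part X) m \<noteq> 0"
    by (auto simp: in_keys_iff lie_scale_affine_def affine_scale_def)
  with assms show "m \<ge> 0" by (simp add: in_keys_iff)
qed

lemma lie_bracket_ge0_closed:
  assumes X: "\<forall>m\<in>keys (loop_part X). m \<ge> 0" and Y: "\<forall>m\<in>keys (loop_part Y). m \<ge> 0"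
  shows "\<forall>m\<in>keys (loop_part (lie_bracket X Y)). m \<ge> 0"
proof -
  have "lookup (loop_part (lie_bracket X Y)) k = 0" if "k < 0" for k
    unfolding lie_bracket_affine_def affine_bracket_def affine_sel_sum lookup_sum
  proof (intro sum.neutral ballI)
    fix m n
    assume "m \<in> keys (loop_part X)" "n \<in> keys (loop_part Y)"
    with X Y have "0 \<le> m" "0 \<le> n" by auto
    with that show "lookup (loop_part (mode_bracket (lookup (loop_part X) m) m
        (lookup (loop_part Y) n) n)) k = 0"
      by (auto simp: mode_bracket_def lookup_single when_def)
  qed
  then show ?thesis
    by (metis in_keys_iff linorder_not_le)
qed

instantiation affine_ge0 :: complex_lie_algebra
begin

lift_definition zero_affine_ge0 :: affine_ge0 is 0 by simp
lift_definition plus_affine_ge0 :: "affine_ge0 \<Rightarrow> affine_ge0 \<Rightarrow> affine_ge0" is "(+)"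
  by (simp add: in_keys_iff lookup_add, metis add_0)
lift_definition minus_affine_ge0 :: "affine_ge0 \<Rightarrow> affine_ge0 \<Rightarrow> affine_ge0" is "(-)"
  by (simp add: in_keys_iff lookup_minus, metis diff_self)
lift_definition uminus_affine_ge0 :: "affine_ge0 \<Rightarrow> affine_ge0" is uminus
  by (auto simp: in_keys_iff)
lift_definition lie_scale_affine_ge0 :: "complex \<Rightarrow> affine_ge0 \<Rightarrow> affine_ge0" is lie_scale
  by (rule lie_scale_ge0_closed[rule_format])
lift_definition lie_bracket_affine_ge0 :: "affine_ge0 \<Rightarrow> affine_ge0 \<Rightarrow> affine_ge0" is lie_bracket
  by (rule lie_bracket_ge0_closed[rule_format])

instance
proof
  fix x y z :: affine_ge0 and c d :: complex
  show "x + y + z = x + (y + z)" "x + y = y + x" "0 + x = x" "- x + x = 0" "x - y = x + - y"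
    by (transfer, simp add: add.assoc add.commute)+
  show "lie_scale c (x + y) = lie_scale c x + lie_scale c y"
    by transfer (rule lie_scale_add_right)
  show "lie_scale (c + d) x = lie_scale c x + lie_scale d x"
    by transfer (rule lie_scale_add_left)
  show "lie_scale c (lie_scale d x) = lie_scale (c * d) x"
    by transfer (rule lie_scale_scale)
  show "lie_scale 1 x = x"
    by transfer (rule lie_scale_one)
  show "lie_bracket (x + y) z = lie_bracket x z + lie_bracket y z"
    by transfer (rule lie_bracket_add_left)
  show "lie_bracket x (y + z) = lie_bracket x y + lie_bracket x z"
    by transfer (rule lie_bracket_add_right)
  show "lie_bracket (lie_scale c x) y = lie_scale c (lie_bracket x y)"
    by transfer (rule lie_bracket_scale_left)
  show "lie_bracket x (lie_scale c y) = lie_scale c (lie_bracket x y)"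
    by transfer (rule lie_bracket_scale_right)
  show "lie_bracket x x = 0"
    by transfer (rule lie_bracket_self)
  show "lie_bracket x (lie_bracket y z) + lie_bracket y (lie_bracket z x)
      + lie_bracket z (lie_bracket x y) = 0"
    by transfer (rule lie_jacobi)
qed

end

instantiation nbar :: complex_lie_algebra
begin

lift_definition zero_nbar :: nbar is 0 by (auto intro!: exI[of _ 0])
lift_definition plus_nbar :: "nbar \<Rightarrow> nbar \<Rightarrow> nbar" is "(+)"
  by (simp add: lookup_add, metis lie_scale_add_left)
lift_definition uminus_nbar :: "nbar \<Rightarrow> nbar" is uminus
proof -
  fix X :: affine
  assume *: "central_part X = 0 \<and> (\<forall>m. \<exists>c. lookup (loop_part X) m = lie_scale c x_alpha)"
  have "- lie_scale c x_alpha = lie_scale (- c) x_alpha" for c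
    using lie_scale_add_left[of c "- c" x_alpha] by (simp add: minus_unique)
  with * show "central_part (- X) = 0 \<and>
      (\<forall>m. \<exists>c. lookup (loop_part (- X)) m = lie_scale c x_alpha)"
    by (simp, metis)
qed
lift_definition minus_nbar :: "nbar \<Rightarrow> nbar \<Rightarrow> nbar" is "(-)"
proof -
  fix X Y :: affine
  assume *: "central_part X = 0 \<and> (\<forall>m. \<exists>c. lookup (loop_part X) m = lie_scale c x_alpha)"
    "central_part Y = 0 \<and> (\<forall>m. \<exists>c. lookup (loop_part Y) m = lie_scale c x_alpha)"
  have "lie_scale c x_alpha - lie_scale d x_alpha = lie_scale (c - d) x_alpha" for c d
    using lie_scale_add_left[of "c - d" d x_alpha] by (simp add: algebra_simps)
  with * show "central_part (X - Y) = 0 \<and>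
      (\<forall>m. \<exists>c. lookup (loop_part (X - Y)) m = lie_scale c x_alpha)"
    by (simp add: lookup_minus, metis)
qed
lift_definition lie_scale_nbar :: "complex \<Rightarrow> nbar \<Rightarrow> nbar" is lie_scale
  by (simp add: lie_scale_affine_def affine_scale_def, metis lie_scale_scale)
lift_definition lie_bracket_nbar :: "nbar \<Rightarrow> nbar \<Rightarrow> nbar" is lie_bracket
proof -
  fix X Y :: affine
  assume *: "central_part X = 0 \<and> (\<forall>m. \<exists>c. lookup (loop_part X) m = lie_scale c x_alpha)"
    "central_part Y = 0 \<and> (\<forall>m. \<exists>c. lookup (loop_part Y) m = lie_scale c x_alpha)"
  have t: "trace_form x_alpha x_alpha = 0"
    by transfer (simp add: mat2_simps)
  have "mode_bracket (lookup (loop_part X) m) m (lookup (loop_part Y) n) n = 0" for m n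
  proof -
    obtain c d where "lookup (loop_part X) m = lie_scale c x_alpha"
      "lookup (loop_part Y) n = lie_scale d x_alpha" using * by blast
    then show ?thesis
      by (simp add: mode_bracket_def zero_affine_def lie_bracket_scale_left
          lie_bracket_scale_right lie_bracket_self trace_form_simps t)
  qed
  then have "lie_bracket X Y = 0"
    by (simp add: lie_bracket_affine_def affine_bracket_def)
  then show "central_part (lie_bracket X Y) = 0 \<and>
      (\<forall>m. \<exists>c. lookup (loop_part (lie_bracket X Y)) m = lie_scale c x_alpha)"
    by (auto intro!: exI[of _ 0])
qed

instance
proof
  fix x y z :: nbar and c d :: complex
  show "x + y + z = x + (y + z)" "x + y = y + x" "0 + x = x" "- x + x = 0" "x - y = x + - y"
    by (transfer, simp add: add.assoc add.commute)+
  show "lie_scale c (x + y) = lie_scale c x + lie_scale c y"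
    by transfer (rule lie_scale_add_right)
  show "lie_scale (c + d) x = lie_scale c x + lie_scale d x"
    by transfer (rule lie_scale_add_left)
  show "lie_scale c (lie_scale d x) = lie_scale (c * d) x"
    by transfer (rule lie_scale_scale)
  show "lie_scale 1 x = x"
    by transfer (rule lie_scale_one)
  show "lie_bracket (x + y) z = lie_bracket x z + lie_bracket y z"
    by transfer (rule lie_bracket_add_left)
  show "lie_bracket x (y + z) = lie_bracket x y + lie_bracket x z"
    by transfer (rule lie_bracket_add_right)
  show "lie_bracket (lie_scale c x) y = lie_scale c (lie_bracket x y)"
    by transfer (rule lie_bracket_scale_left)
  show "lie_bracket x (lie_scale c y) = lie_scale c (lie_bracket x y)"
    by transfer (rule lie_bracket_scale_right)
  show "lie_bracket x x = 0"
    by transfer (rule lie_bracket_self)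
  show "lie_bracket x (lie_bracket y z) + lie_bracket y (lie_bracket z x)
      + lie_bracket z (lie_bracket x y) = 0"
    by transfer (rule lie_jacobi)
qed

end


section \<open>The generalized Verma module\<close>

text \<open>
  The left action of \<open>U(affine_ge0)\<close> on the one-dimensional module on which the loop part acts
  by 0 and the central element by 1, and the canonical map from \<open>U(affine_ge0)\<close> to \<open>U(affine)\<close>
  (the action of \<open>U(affine_ge0)\<close> on \<open>U(affine)\<close> by left multiplication, applied to 1).
\<close>

definition vac_line_act :: "affine_ge0 uea \<Rightarrow> complex \<Rightarrow> complex"
  where "vac_line_act = uea_act (*) (\<lambda>X z. central_part (Rep_affine_ge0 X) * z)"

definition uea_ge0_incl :: "affine_ge0 uea \<Rightarrow> affine uea"
  where "uea_ge0_incl b = uea_act uea_scale (\<lambda>X u. uea_incl (Rep_affine_ge0 X) * u) b 1"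

definition pure :: "affine uea \<Rightarrow> complex \<Rightarrow> (affine uea \<times> complex) \<Rightarrow>\<^sub>0 complex"
  where "pure u z = single (u, z) 1"

definition tensor_relators :: "((affine uea \<times> complex) \<Rightarrow>\<^sub>0 complex) set"
  where "tensor_relators =
    {pure (u + u') z - pure u z - pure u' z | u u' z. True}
    \<union> {pure u (z + z') - pure u z - pure u z' | u z z'. True}
    \<union> {pure (uea_scale c u) z - pm_scale c (pure u z) | c u z. True}
    \<union> {pure u (c * z) - pm_scale c (pure u z) | c u z. True}
    \<union> {pure (u * uea_ge0_incl b) z - pure u (vac_line_act b z) | u b z. True}"

definition tensor_null :: "((affine uea \<times> complex) \<Rightarrow>\<^sub>0 complex) set"
  where "tensor_null = pm.span tensor_relators"

lemma tensor_null_add: "x \<in> tensor_null \<Longrightarrow> y \<in> tensor_null \<Longrightarrow> x + y \<in> tensor_null"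
  unfolding tensor_null_def by (rule pm.span_add)

lemma tensor_null_diff: "x \<in> tensor_null \<Longrightarrow> y \<in> tensor_null \<Longrightarrow> x - y \<in> tensor_null"
  unfolding tensor_null_def by (rule pm.span_diff)

lemma tensor_null_zero: "0 \<in> tensor_null"
  unfolding tensor_null_def by (rule pm.span_zero)

lemma tensor_null_scale: "x \<in> tensor_null \<Longrightarrow> pm_scale c x \<in> tensor_null"
  unfolding tensor_null_def by (rule pm.span_scale)

text \<open>
  The tensor product of \<open>U(affine)\<close> with the one-dimensional module over \<open>U(affine_ge0)\<close>.
\<close>

quotient_type verma = "(affine uea \<times> complex) \<Rightarrow>\<^sub>0 complex" / "\<lambda>p q. p - q \<in> tensor_null"
proof (rule equivpI)
  show "reflp (\<lambda>p q. p - q \<in> tensor_null)"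
    by (auto intro!: reflpI simp: tensor_null_zero)
  show "symp (\<lambda>p q. p - q \<in> tensor_null)"
  proof (rule sympI)
    fix p q
    assume "p - q \<in> tensor_null"
    from tensor_null_diff[OF tensor_null_zero this] show "q - p \<in> tensor_null" by simp
  qed
  show "transp (\<lambda>p q. p - q \<in> tensor_null)"
  proof (rule transpI)
    fix p q r
    assume "p - q \<in> tensor_null" "q - r \<in> tensor_null"
    from tensor_null_add[OF this] show "p - r \<in> tensor_null" by simp
  qed
qed

instantiation verma :: ab_group_add
begin

lift_definition zero_verma :: verma is 0 .
lift_definition plus_verma :: "verma \<Rightarrow> verma \<Rightarrow> verma" is "(+)"
proof -
  fix a b c d
  assume "a - b \<in> tensor_null" "c - d \<in> tensor_null"
  from tensor_null_add[OF this] show "a + c - (b + d) \<in> tensor_null" by (simp add: algebra_simps)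
qed
lift_definition minus_verma :: "verma \<Rightarrow> verma \<Rightarrow> verma" is "(-)"
proof -
  fix a b c d
  assume "a - b \<in> tensor_null" "c - d \<in> tensor_null"
  from tensor_null_diff[OF this] show "a - c - (b - d) \<in> tensor_null" by (simp add: algebra_simps)
qed
lift_definition uminus_verma :: "verma \<Rightarrow> verma" is uminus
proof -
  fix a b
  assume "a - b \<in> tensor_null"
  from tensor_null_diff[OF tensor_null_zero this] show "- a - - b \<in> tensor_null" by simp
qed

instance
proof
  fix a b c :: verma
  show "a + b + c = a + (b + c)" "a + b = b + a" "0 + a = a"
    by (transfer, simp add: add.assoc add.commute tensor_null_zero)+
  show "- a + a = 0" "a - b = a + - b"
    by (transfer, simp add: tensor_null_zero)+
qed

end

lift_definition verma_scale :: "complex \<Rightarrow> verma \<Rightarrow> verma" is pm_scale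
  by (simp add: tensor_null_scale flip: pm.scale_right_diff_distrib)

definition left_mult ::
    "affine uea \<Rightarrow> ((affine uea \<times> complex) \<Rightarrow>\<^sub>0 complex) \<Rightarrow> ((affine uea \<times> complex) \<Rightarrow>\<^sub>0 complex)"
  where "left_mult a = lin_ext pm_scale (\<lambda>(u, z). pure (a * u) z)"

lemma left_mult_add: "left_mult a (p + q) = left_mult a p + left_mult a q"
  unfolding left_mult_def by (rule lin_ext_add[OF pm.vector_space_axioms])

lemma left_mult_diff: "left_mult a (p - q) = left_mult a p - left_mult a q"
  unfolding left_mult_def by (rule lin_ext_minus[OF pm.vector_space_axioms])

lemma left_mult_scale: "left_mult a (pm_scale c p) = pm_scale c (left_mult a p)"
  unfolding left_mult_def by (rule lin_ext_pm_scale[OF pm.vector_space_axioms])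

lemma left_mult_pure: "left_mult a (pure u z) = pure (a * u) z"
  by (simp add: left_mult_def pure_def lin_ext_single[OF pm.vector_space_axioms])

lemma uea_scale_mult_right: "a * uea_scale c u = uea_scale c (a * u)"
  by transfer (simp add: pm_scale_mult_right uea_ideal_zero)

lemma uea_scale_mult_left: "uea_scale c a * u = uea_scale c (a * u)"
  by transfer (simp add: pm_scale_mult_left uea_ideal_zero)

lemma left_mult_relator: "r \<in> tensor_relators \<Longrightarrow> left_mult a r \<in> tensor_relators"
  unfolding tensor_relators_def
  by (elim UnE CollectE exE conjE; simp only: left_mult_diff left_mult_scale left_mult_pure
      distrib_left uea_scale_mult_right flip: mult.assoc) blast+

lemma left_mult_null: "p \<in> tensor_null \<Longrightarrow> left_mult a p \<in> tensor_null"
  unfolding tensor_null_def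
proof (induction p rule: pm.span_induct_alt)
  case base
  then show ?case by (simp add: left_mult_def pm.span_zero)
next
  case (step c x y)
  then show ?case
    by (simp add: left_mult_add left_mult_scale pm.span_add pm.span_scale pm.span_base
        left_mult_relator)
qed

lift_definition verma_act :: "affine \<Rightarrow> verma \<Rightarrow> verma" is "\<lambda>X. left_mult (uea_incl X)"
  by (simp add: left_mult_null flip: left_mult_diff)

lift_definition verma_vac :: verma is "pure 1 1" .

lemma verma_span_induct [case_names pure add scale]:
  assumes "\<And>u z. P (abs_verma (pure u z))"
    and "\<And>v w. P v \<Longrightarrow> P w \<Longrightarrow> P (v + w)" and "\<And>c v. P v \<Longrightarrow> P (verma_scale c v)"
  shows "P v"
proof -
  obtain p where v: "v = abs_verma p"
    using Quotient3_abs_rep[OF Quotient3_verma, of v] by metis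
  obtain A f where p: "finite A" "p = (\<Sum>k\<in>A. single k (f k))" by (rule pm_expand)
  have z: "P (abs_verma 0)"
    using assms(3)[OF assms(1), of 0 0 0] by (simp add: verma_scale.abs_eq)
  have "P (abs_verma (\<Sum>k\<in>A. single k (f k)))"
    using p(1)
  proof (induction A)
    case empty
    then show ?case using z by simp
  next
    case (insert k A)
    have "single k (f k) = pm_scale (f k) (pure (fst k) (snd k))"
      by (rule poly_mapping_eqI) (simp add: pure_def lookup_single when_def)
    then have "P (abs_verma (single k (f k)))"
      using assms(3)[OF assms(1), of "f k" "fst k" "snd k"] by (simp add: verma_scale.abs_eq)
    from assms(2)[OF this insert(3)] insert show ?case by (simp add: plus_verma.abs_eq)
  qed
  then show ?thesis by (simp add: v p)
qed

lemma verma_pure_rel: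
  "abs_verma (pure (u + u') z) = abs_verma (pure u z) + abs_verma (pure u' z)"
  "abs_verma (pure (uea_scale c u) z) = verma_scale c (abs_verma (pure u z))"
proof -
  have "pure (u + u') z - (pure u z + pure u' z) \<in> tensor_null"
    unfolding tensor_null_def tensor_relators_def diff_diff_eq[symmetric]
    by (rule pm.span_base) blast
  then show "abs_verma (pure (u + u') z) = abs_verma (pure u z) + abs_verma (pure u' z)"
    by (simp add: plus_verma.abs_eq verma.abs_eq_iff)
  have "pure (uea_scale c u) z - pm_scale c (pure u z) \<in> tensor_null"
    unfolding tensor_null_def tensor_relators_def
    by (rule pm.span_base) blast
  then show "abs_verma (pure (uea_scale c u) z) = verma_scale c (abs_verma (pure u z))"
    by (simp add: verma_scale.abs_eq verma.abs_eq_iff)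
qed

lemma uea_incl_add: "uea_incl (X + Y) = uea_incl X + uea_incl Y"
proof transfer
  fix X Y :: 'a
  have "letter (X + Y) - letter X - letter Y \<in> uea_ideal"
    by (rule uea_ideal_relator) (auto simp: uea_relators_def)
  then show "letter (X + Y) - (letter X + letter Y) \<in> uea_ideal" by (simp add: diff_diff_eq)
qed

lemma uea_incl_scale: "uea_incl (lie_scale c X) = uea_scale c (uea_incl X)"
  by transfer (rule uea_ideal_relator, auto simp: uea_relators_def)

lemma uea_incl_bracket:
  "uea_incl (lie_bracket X Y) = uea_incl X * uea_incl Y - uea_incl Y * uea_incl X"
proof transfer
  fix X Y :: 'a
  have "letter X * letter Y - letter Y * letter X - letter (lie_bracket X Y) \<in> uea_ideal"
    by (rule uea_ideal_relator) (auto simp: uea_relators_def)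
  from uea_ideal_diff[OF uea_ideal_zero this]
  show "letter (lie_bracket X Y) - (letter X * letter Y - letter Y * letter X) \<in> uea_ideal" by simp
qed

lemma verma_act_pure: "verma_act X (abs_verma (pure u z)) = abs_verma (pure (uea_incl X * u) z)"
  by (simp add: verma_act.abs_eq left_mult_pure)

lemma verma_vector_space: "vector_space verma_scale"
  by unfold_locales
     (transfer, simp add: pm.scale_right_distrib pm.scale_left_distrib tensor_null_zero)+

lemma verma_act_add_right: "verma_act X (v + w) = verma_act X v + verma_act X w"
  by transfer (simp add: left_mult_add tensor_null_zero)

lemma verma_act_scale_right: "verma_act X (verma_scale c v) = verma_scale c (verma_act X v)"
  by transfer (simp add: left_mult_scale tensor_null_zero)

lemma verma_lie_module: "lie_module verma_scale verma_act"
proof -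
  interpret vector_space verma_scale by (rule verma_vector_space)
  show ?thesis
  proof
    fix X Y :: affine and v w :: verma and c :: complex
    show "verma_act X (v + w) = verma_act X v + verma_act X w"
      by (rule verma_act_add_right)
    show "verma_act X (verma_scale c v) = verma_scale c (verma_act X v)"
      by (rule verma_act_scale_right)
    show "verma_act (X + Y) v = verma_act X v + verma_act Y v"
    proof (induction v rule: verma_span_induct)
      case (pure u z)
      show ?case by (simp add: verma_act_pure uea_incl_add distrib_right verma_pure_rel)
    next
      case (add v w)
      then show ?case by (simp add: verma_act_add_right algebra_simps)
    next
      case (scale c v)
      then show ?case by (simp add: verma_act_scale_right scale_right_distrib)
    qed
    show "verma_act (lie_scale c X) v = verma_scale c (verma_act X v)"
    proof (induction v rule: verma_span_induct)
      case (pure u z)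
      show ?case by (simp add: verma_act_pure uea_incl_scale uea_scale_mult_left verma_pure_rel)
    next
      case (add v w)
      then show ?case by (simp add: verma_act_add_right scale_right_distrib)
    next
      case (scale d v)
      then show ?case by (simp add: verma_act_scale_right mult.commute)
    qed
    show "verma_act (lie_bracket X Y) v = verma_act X (verma_act Y v) - verma_act Y (verma_act X v)"
    proof (induction v rule: verma_span_induct)
      case (pure u z)
      have "uea_incl X * uea_incl Y = uea_incl (lie_bracket X Y) + uea_incl Y * uea_incl X"
        by (simp add: uea_incl_bracket)
      from arg_cong[OF this, of "\<lambda>a. abs_verma (pure (a * u) z)"]
      show ?case by (simp add: verma_act_pure distrib_right verma_pure_rel mult.assoc)
    next
      case (add v w)
      then show ?case by (simp add: verma_act_add_right)
    next
      case (scale d v)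
      then show ?case by (simp add: verma_act_scale_right scale_right_diff_distrib)
    qed
  qed
qed

lemma uea_ge0_module:
  "lie_module uea_scale (\<lambda>X u. uea_incl (Rep_affine_ge0 X) * u)"
proof -
  have vs: "vector_space (uea_scale :: complex \<Rightarrow> affine uea \<Rightarrow> affine uea)"
    by unfold_locales
       (transfer, simp add: pm.scale_right_distrib pm.scale_left_distrib uea_ideal_zero)+
  interpret vector_space "uea_scale :: complex \<Rightarrow> affine uea \<Rightarrow> affine uea" by (rule vs)
  show ?thesis
    by unfold_locales
       (simp_all add: plus_affine_ge0.rep_eq lie_scale_affine_ge0.rep_eq lie_bracket_affine_ge0.rep_eq
          uea_incl_add uea_incl_scale uea_incl_bracket distrib_left distrib_right left_diff_distrib
          uea_scale_mult_left uea_scale_mult_right mult.assoc)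
qed

lemma central_part_bracket_ge0:
  "central_part (lie_bracket (Rep_affine_ge0 X) (Rep_affine_ge0 Y)) = 0"
  unfolding lie_bracket_affine_def affine_bracket_def affine_sel_sum
proof (intro sum.neutral ballI)
  fix m n
  assume "m \<in> keys (loop_part (Rep_affine_ge0 X))" "n \<in> keys (loop_part (Rep_affine_ge0 Y))"
  then have "0 \<le> m" "0 \<le> n" using Rep_affine_ge0[of X] Rep_affine_ge0[of Y] by auto
  then show "central_part (mode_bracket (lookup (loop_part (Rep_affine_ge0 X)) m) m
      (lookup (loop_part (Rep_affine_ge0 Y)) n) n) = 0"
    by (auto simp: mode_bracket_def)
qed

lemma vac_line_module:
  "lie_module (*) (\<lambda>X z. central_part (Rep_affine_ge0 X) * z)"
proof -
  interpret vector_space "(*) :: complex \<Rightarrow> complex \<Rightarrow> complex"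
    by unfold_locales (simp_all add: algebra_simps)
  show ?thesis
    by unfold_locales
       (simp_all add: plus_affine_ge0.rep_eq lie_scale_affine_ge0.rep_eq lie_bracket_affine_ge0.rep_eq
          central_part_bracket_ge0 lie_scale_affine_def affine_scale_def distrib_right distrib_left
          mult.left_commute)
qed

lemma verma_act_vac:
  assumes "\<And>m. m < 0 \<Longrightarrow> lookup (loop_part X) m = 0"
  shows "verma_act X verma_vac = verma_scale (central_part X) verma_vac"
proof -
  have X: "X \<in> {X. \<forall>m\<in>keys (loop_part X). m \<ge> 0}"
    using assms by (auto simp: in_keys_iff) (metis linorder_not_le)
  define b where "b = uea_incl (Abs_affine_ge0 X)"
  have 1: "uea_ge0_incl b = uea_incl X"
    by (simp add: uea_ge0_incl_def b_def lie_module.uea_act_incl[OF uea_ge0_module]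
        Abs_affine_ge0_inverse[OF X])
  have 2: "vac_line_act b 1 = central_part X"
    by (simp add: vac_line_act_def b_def lie_module.uea_act_incl[OF vac_line_module]
        Abs_affine_ge0_inverse[OF X])
  have "pure (1 * uea_ge0_incl b) 1 - pure 1 (vac_line_act b 1) \<in> tensor_null"
    unfolding tensor_null_def tensor_relators_def by (rule pm.span_base) blast
  then have 3: "pure (uea_incl X) 1 - pure 1 (central_part X) \<in> tensor_null"
    by (simp add: 1 2)
  have "pure 1 (central_part X * 1) - pm_scale (central_part X) (pure 1 1) \<in> tensor_null"
    unfolding tensor_null_def tensor_relators_def by (rule pm.span_base) blast
  from tensor_null_add[OF 3 this]
  show ?thesis
    by (simp add: verma_vac_def verma_act_pure verma_scale.abs_eq verma.abs_eq_iff)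
qed


section \<open>Standard modules and principal subspaces\<close>

definition highest_weight_module_\<Lambda>0 ::
    "(complex \<Rightarrow> 'v \<Rightarrow> 'v) \<Rightarrow> (affine \<Rightarrow> 'v \<Rightarrow> 'v) \<Rightarrow> 'v::ab_group_add \<Rightarrow> bool"
  where "highest_weight_module_\<Lambda>0 s act v \<longleftrightarrow>
    lie_module s act \<and> v \<noteq> 0 \<and>
    act (mode x_alpha 0) v = 0 \<and> (\<forall>a m. m > 0 \<longrightarrow> act (mode a m) v = 0) \<and>
    act (mode h_elt 0) v = 0 \<and> (\<forall>w. act central w = w) \<and>
    (\<forall>w. \<exists>u. w = uea_act s act u v)"

text \<open>\<open>L(\<Lambda>0)\<close> is determined up to isomorphism; the predicate says that \<open>s\<close>, \<open>act\<close> is a copy of it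
  with highest weight vector \<open>v\<close>.\<close>

definition standard_module_\<Lambda>0 ::
    "(complex \<Rightarrow> 'v \<Rightarrow> 'v) \<Rightarrow> (affine \<Rightarrow> 'v \<Rightarrow> 'v) \<Rightarrow> 'v::ab_group_add \<Rightarrow> bool"
  where "standard_module_\<Lambda>0 s act v \<longleftrightarrow>
    highest_weight_module_\<Lambda>0 s act v \<and> lie_module.irreducible_module s act"

text \<open>\<open>U(nbar) v\<close>, with \<open>nbar\<close> acting by restriction.\<close>

definition principal_subspace ::
    "(complex \<Rightarrow> 'v \<Rightarrow> 'v) \<Rightarrow> (affine \<Rightarrow> 'v \<Rightarrow> 'v) \<Rightarrow> 'v::ab_group_add \<Rightarrow> 'v set"
  where "principal_subspace s act v =
    range (\<lambda>u :: nbar uea. uea_act s (\<lambda>X. act (Rep_nbar X)) u v)"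


section \<open>Vertex algebras\<close>

text \<open>\<open>Y v n w\<close> is the n-th mode of \<open>v\<close> applied to \<open>w\<close>.  The sums in the component form of the
  Jacobi identity are finite by the truncation axiom.\<close>

locale vertex_algebra = vector_space scale
  for scale :: "complex \<Rightarrow> 'v::ab_group_add \<Rightarrow> 'v" +
  fixes Y :: "'v \<Rightarrow> int \<Rightarrow> 'v \<Rightarrow> 'v" and vac :: 'v
  assumes Y_add_left: "Y (u + v) n w = Y u n w + Y v n w"
    and Y_scale_left: "Y (scale c u) n w = scale c (Y u n w)"
    and Y_add_right: "Y u n (v + w) = Y u n v + Y u n w"
    and Y_scale_right: "Y u n (scale c w) = scale c (Y u n w)"
    and truncation: "\<exists>N. \<forall>n\<ge>N. Y u n v = 0"
    and vacuum: "Y vac n v = (if n = -1 then v else 0)"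
    and creation: "Y v (-1) vac = v" "n \<ge> 0 \<Longrightarrow> Y v n vac = 0"
    and jacobi:
      "Sum_any (\<lambda>i::nat. scale (of_int m gchoose i) (Y (Y u (l + int i) v) (m + n - int i) w)) =
       Sum_any (\<lambda>i::nat. scale ((-1) ^ i * (of_int l gchoose i))
         (Y u (m + l - int i) (Y v (n + int i) w)
           - scale ((-1) powi l) (Y v (n + l - int i) (Y u (m + int i) w))))"
begin

definition vertex_subalgebra :: "'v set \<Rightarrow> bool"
  where "vertex_subalgebra V \<longleftrightarrow>
    subspace V \<and> vac \<in> V \<and> (\<forall>v\<in>V. \<forall>w\<in>V. \<forall>n. Y v n w \<in> V)"

text \<open>Ideals of the vertex algebra \<open>V\<close>, where \<open>V\<close> is a vertex subalgebra of the ambient one.\<close>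

definition va_ideal :: "'v set \<Rightarrow> 'v set \<Rightarrow> bool"
  where "va_ideal V I \<longleftrightarrow>
    subspace I \<and> I \<subseteq> V \<and> (\<forall>v\<in>V. \<forall>w\<in>I. \<forall>n. Y v n w \<in> I \<and> Y w n v \<in> I)"

definition principal_ideal :: "'v set \<Rightarrow> 'v \<Rightarrow> 'v set"
  where "principal_ideal V v = \<Inter>{I. va_ideal V I \<and> v \<in> I}"

end

locale vertex_operator_algebra = vertex_algebra scale Y vac
  for scale :: "complex \<Rightarrow> 'v::ab_group_add \<Rightarrow> 'v" and Y vac +
  fixes \<omega> :: 'v and central_charge :: complex
  assumes virasoro:
      "Y \<omega> (m + 1) (Y \<omega> (n + 1) v) - Y \<omega> (n + 1) (Y \<omega> (m + 1) v) =
        scale (of_int (m - n)) (Y \<omega> (m + n + 1) v)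
        + scale (if m + n = 0 then of_int (m ^ 3 - m) / 12 * central_charge else 0) v"
    and derivative: "Y (Y \<omega> 0 v) n w = scale (- of_int n) (Y v (n - 1) w)"
    and grading_span: "span (\<Union>n::int. {v. Y \<omega> 1 v = scale (of_int n) v}) = UNIV"
    and grading_finite_dim: "\<exists>B. finite B \<and> {v. Y \<omega> 1 v = scale (of_int n) v} \<subseteq> span B"
    and grading_bounded_below: "\<exists>N::int. \<forall>n<N. {v. Y \<omega> 1 v = scale (of_int n) v} = {0}"

text \<open>
  The Sugawara vector at level 1: the dual Coxeter number is 2, and the bases
  \<open>x_alpha, x_minus_alpha, h\<close> and \<open>x_minus_alpha, x_alpha, h/2\<close> are dual for the trace form.
  The central charge is \<open>1 * 3 / (1 + 2) = 1\<close>.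
\<close>

definition sugawara_vector :: verma
  where "sugawara_vector = verma_scale (1 / (2 * (1 + 2)))
    (verma_act (mode x_alpha (-1)) (verma_act (mode x_minus_alpha (-1)) verma_vac)
     + verma_act (mode x_minus_alpha (-1)) (verma_act (mode x_alpha (-1)) verma_vac)
     + verma_act (mode h_elt (-1)) (verma_act (mode (lie_scale (1/2) h_elt) (-1)) verma_vac))"

text \<open>The condition on the generating fields determines \<open>Y\<close> uniquely.\<close>

definition standard_voa_structure :: "(verma \<Rightarrow> int \<Rightarrow> verma \<Rightarrow> verma) \<Rightarrow> bool"
  where "standard_voa_structure Y \<longleftrightarrow>
    vertex_operator_algebra verma_scale Y verma_vac sugawara_vector 1 \<and>
    (\<forall>a m w. Y (verma_act (mode a (-1)) verma_vac) m w = verma_act (mode a m) w)"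

definition W_N :: "verma set"
  where "W_N = principal_subspace verma_scale verma_act verma_vac"

definition x_alpha_squared_vac :: verma
  where "x_alpha_squared_vac =
    verma_act (mode x_alpha (-1)) (verma_act (mode x_alpha (-1)) verma_vac)"

end

theory Submission
  imports Defs
begin

text \<open>
  Let \<open>K\<close> be the kernel of the surjection onto \<open>L(\<Lambda>0)\<close>, and \<open>J\<close>, \<open>I\<close> the ideals of \<open>N(\<Lambda>0)\<close>, \<open>W\<^sup>N\<close> generated by
  \<open>x(-1)\<^sup>2 v\<close>.  That vector is singular of weight 2, so it generates a proper submodule and lies in \<open>K\<close>;
  submodules are ideals, hence \<open>I \<subseteq> J \<inter> W\<^sup>N \<subseteq> K \<inter> W\<^sup>N\<close>.  For \<open>K \<inter> W\<^sup>N \<subseteq> I\<close> no realization of \<open>L(\<Lambda>0)\<close> is needed.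
  The modes of \<open>x(-1)\<^sup>2 v\<close> give the quadratic relations \<open>\<Sum>\<^bsub>i+j=t\<^esub> x(-i) x(-j) = 0\<close> modulo \<open>I\<close>, and these reduce
  every element of \<open>W\<^sup>N\<close> modulo \<open>I\<close> to monomials whose indices differ by at least 2.  These monomials stay independent
  modulo \<open>K\<close>: the operators \<open>h(n)\<close>, \<open>n > 0\<close>, preserve \<open>K\<close> and act on monomials as twice
  the power sums in the shifts \<open>x(-m) \<mapsto> x(-m+1)\<close> of the single factors,
  so \<open>K\<close> is also preserved by the operators \<open>E\<^sub>r\<close> corresponding to elementary symmetric polynomials.  Powers of the
  \<open>E\<^sub>r\<close> move a nontrivial combination of such monomials to a nonzero multiple of an extremal vector
  \<open>u\<^sub>j = x(-(2j-1)) \<dots> x(-3) x(-1) v\<close>, and \<open>u\<^sub>j \<notin> K\<close> because \<open>x\<^bsub>-\<alpha>\<^esub>(2j-1) u\<^sub>j = u\<^bsub>j-1\<^esub>\<close> modulo \<open>I\<close>.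
\<close>

section \<open>Modes of the generalized Verma module\<close>

interpretation vm: lie_module verma_scale verma_act
  by (rule verma_lie_module)

text \<open>Words in the letters span the enveloping algebra, and the scalar of a pure tensor can be
  pulled out, so the module is cyclic on the vacuum.\<close>

lemma verma_act_induct [case_names vac act add scale]:
  assumes vac: "P verma_vac" and act: "\<And>X v. P v \<Longrightarrow> P (verma_act X v)"
    and add: "\<And>v w. P v \<Longrightarrow> P w \<Longrightarrow> P (v + w)" and scale: "\<And>c v. P v \<Longrightarrow> P (verma_scale c v)"
  shows "P v"
proof (induction v rule: verma_span_induct)
  case (pure u z)
  have word: "P (abs_verma (pure (abs_uea (single (Word l) 1)) 1))" for l :: "affine list"
  proof (induction l)
    case Nil
    have "abs_uea (single (Word []) 1) = (1 :: affine uea)"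
      by (simp add: one_uea.abs_eq single_one flip: zero_word_def)
    then show ?case using vac by (simp add: verma_vac_def)
  next
    case (Cons a l)
    have "abs_uea (single (Word (a # l)) 1) = uea_incl a * abs_uea (single (Word l) 1)"
      by (simp add: uea_incl.abs_eq times_uea.abs_eq letter_def mult_single plus_word_def)
    then show ?case using act[OF Cons, of a] by (simp add: verma_act_pure)
  qed
  obtain p where u: "u = abs_uea p" by (rule uea_cases)
  obtain A f where p: "finite A" "p = (\<Sum>k\<in>A. single k (f k))" by (rule pm_expand)
  have "P (abs_verma (pure (abs_uea (\<Sum>k\<in>A. single k (f k))) 1))"
    using p(1)
  proof (induction A)
    case empty
    \<comment> \<open>Zero is written as 0 times a word, so that closure under scaling yields
      \<open>P 0\<close>.\<close>
    have "abs_verma (pure (abs_uea (pm_scale 0 (single (Word []) 1))) 1)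
        = verma_scale 0 (abs_verma (pure (abs_uea (single (Word []) 1)) 1))"
      by (simp only: uea_scale.abs_eq[symmetric] verma_pure_rel)
    then show ?case using scale[OF word, of 0 "[]"] by simp
  next
    case (insert k A)
    have k: "single k (f k) = pm_scale (f k) (single (Word (letters k)) 1)"
      by (rule poly_mapping_eqI) (simp add: lookup_single when_def)
    have "P (abs_verma (pure (abs_uea (single k (f k))) 1))"
      unfolding k uea_scale.abs_eq[symmetric] verma_pure_rel by (rule scale[OF word])
    from add[OF this insert(3)] show ?case
      using insert by (simp add: plus_uea.abs_eq[symmetric] verma_pure_rel)
  qed
  moreover have "pure u (z * 1) - pm_scale z (pure u 1) \<in> tensor_null"
    unfolding tensor_null_def tensor_relators_def by (rule pm.span_base) blast
  then have "abs_verma (pure u z) = verma_scale z (abs_verma (pure u 1))"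
    by (simp add: verma_scale.abs_eq verma.abs_eq_iff)
  ultimately show ?case using scale by (simp add: u p)
qed (fact add scale)+

lemma lie_bracket_central: "lie_bracket central X = 0"
  by (simp add: lie_bracket_affine_def central_def)

text \<open>The value 1 on the vacuum propagates to the whole module because \<open>central\<close>
  commutes with every \<open>X\<close>.\<close>

lemma verma_act_central [simp]: "verma_act central v = v"
proof (induction v rule: verma_act_induct)
  case vac
  show ?case by (subst verma_act_vac) (simp_all add: central_def)
next
  case (act X v)
  then show ?case using vm.act_bracket[of central X v]
    by (simp add: lie_bracket_central vm.act_scale_left[of 0 0, simplified])
qed (simp_all add: vm.act_add_right vm.act_scale_right)

lemma verma_act_Affine_0 [simp]: "verma_act (Affine 0 c) v = verma_scale c v"
proof -
  have "Affine 0 c = lie_scale c central"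
    by (auto simp: lie_scale_affine_def affine_scale_def central_def intro!: poly_mapping_eqI)
  then show ?thesis by (simp add: vm.act_scale_left)
qed

lemma verma_act_mode_swap:
  "verma_act (mode a m) (verma_act (mode b n) v) =
    verma_act (mode b n) (verma_act (mode a m) v) + verma_act (mode (lie_bracket a b) (m + n)) v
      + verma_scale (if m + n = 0 then of_int m * trace_form a b else 0) v"
proof -
  have "lie_bracket (mode a m) (mode b n) = mode (lie_bracket a b) (m + n)
      + Affine 0 (if m + n = 0 then of_int m * trace_form a b else 0)"
    unfolding lie_bracket_affine_def affine_bracket_mode
    by (simp add: mode_bracket_def mode_def plus_affine_def)
  then show ?thesis
    using vm.act_bracket[of "mode a m" "mode b n" v] by (simp add: vm.act_add_left algebra_simps)
qed

lemma mode_add: "mode (a + b) m = mode a m + mode b m"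
  by (simp add: mode_def plus_affine_def single_add)

lemma mode_lie_scale: "mode (lie_scale c a) m = lie_scale c (mode a m)"
  by (simp add: mode_def lie_scale_affine_def affine_scale_def map_lie_scale_single)

lemma verma_mode_induct [case_names vac mode add scale]:
  assumes vac: "P verma_vac" and mode: "\<And>a m v. P v \<Longrightarrow> P (verma_act (mode a m) v)"
    and add: "\<And>v w. P v \<Longrightarrow> P w \<Longrightarrow> P (v + w)" and scale: "\<And>c v. P v \<Longrightarrow> P (verma_scale c v)"
  shows "P v"
proof (induction v rule: verma_act_induct)
  case (act X v)
  show ?case
    by (induction X rule: affine_induct) (simp_all add: act mode scale add vm.act_add_left)
qed (fact vac add scale)+

lemma verma_act_mode_vac: "m \<ge> 0 \<Longrightarrow> verma_act (mode a m) verma_vac = 0"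
  by (subst verma_act_vac) (auto simp: mode_def lookup_single when_def)

abbreviation "ea m \<equiv> verma_act (mode x_alpha m)"
abbreviation "ha m \<equiv> verma_act (mode h_elt m)"
abbreviation "fa m \<equiv> verma_act (mode x_minus_alpha m)"

lemma trace_form_basis:
  "trace_form x_alpha x_alpha = 0" "trace_form x_minus_alpha x_minus_alpha = 0"
  "trace_form x_alpha x_minus_alpha = 1" "trace_form x_minus_alpha x_alpha = 1"
  "trace_form h_elt h_elt = 2" "trace_form h_elt x_alpha = 0" "trace_form x_alpha h_elt = 0"
  "trace_form h_elt x_minus_alpha = 0" "trace_form x_minus_alpha h_elt = 0"
  by (transfer, simp (no_asm) add: mat2_simps)+

lemma lie_bracket_basis:
  "lie_bracket x_alpha h_elt = lie_scale (-2) x_alpha"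
  "lie_bracket x_minus_alpha h_elt = lie_scale 2 x_minus_alpha"
  "lie_bracket x_minus_alpha x_alpha = lie_scale (-1) h_elt"
  by (transfer, simp (no_asm) add: mat2_simps)+

lemma mode_zero: "verma_act (mode 0 m) v = 0"
  using vm.act_scale_left[of 0 "mode 0 m" v] by (simp add: mode_def lie_scale_affine_def affine_scale_def)

lemma ea_commute: "ea m (ea n v) = ea n (ea m v)"
  by (simp add: verma_act_mode_swap[of x_alpha m] lie_bracket_self trace_form_basis mode_zero)

lemma ha_ea: "ha m (ea n v) = ea n (ha m v) + verma_scale 2 (ea (m + n) v)"
  by (simp add: verma_act_mode_swap[of h_elt m x_alpha] sl2_relations trace_form_basis mode_lie_scale vm.act_scale_left)

lemma fa_ea: "fa m (ea n v) =
    ea n (fa m v) - ha (m + n) v + verma_scale (if m + n = 0 then of_int m else 0) v"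
  by (simp add: verma_act_mode_swap[of x_minus_alpha m x_alpha] lie_bracket_basis trace_form_basis mode_lie_scale vm.act_scale_left)


section \<open>The principal subspace and submodules as ideals\<close>

lemma nbar_lie_module: "lie_module verma_scale (\<lambda>X. verma_act (Rep_nbar X))"
  by unfold_locales
     (simp_all add: plus_nbar.rep_eq lie_scale_nbar.rep_eq lie_bracket_nbar.rep_eq
        vm.act_add_left vm.act_scale_left vm.act_add_right vm.act_scale_right vm.act_bracket)

lemma W_N_iff: "v \<in> W_N \<longleftrightarrow> (\<exists>u. v = uea_act verma_scale (\<lambda>X. verma_act (Rep_nbar X)) u verma_vac)"
  by (auto simp: W_N_def principal_subspace_def)

lemma W_N_vac: "verma_vac \<in> W_N"
  unfolding W_N_iff by (rule exI[of _ 1]) (simp add: lie_module.uea_act_one[OF nbar_lie_module])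

lemma subspace_W_N: "vm.subspace W_N"
proof (rule vm.subspaceI)
  show "0 \<in> W_N"
    unfolding W_N_iff
    by (rule exI[of _ "uea_scale 0 1"]) (simp add: lie_module.uea_act_scale[OF nbar_lie_module])
  show "v + w \<in> W_N" if "v \<in> W_N" "w \<in> W_N" for v w
    using that unfolding W_N_iff by (metis lie_module.uea_act_add[OF nbar_lie_module])
  show "verma_scale c v \<in> W_N" if "v \<in> W_N" for c v
    using that unfolding W_N_iff by (metis lie_module.uea_act_scale[OF nbar_lie_module])
qed

lemma W_N_ea: "v \<in> W_N \<Longrightarrow> ea m v \<in> W_N"
proof -
  have "mode x_alpha m \<in> {X. central_part X = 0 \<and> (\<forall>m. \<exists>c. lookup (loop_part X) m = lie_scale c x_alpha)}"
    by (auto simp: mode_def lookup_single when_def lie_scale_one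
        intro: exI[of _ 0] exI[of _ 1])
  then have "Rep_nbar (Abs_nbar (mode x_alpha m)) = mode x_alpha m"
    by (rule Abs_nbar_inverse)
  then have "uea_act verma_scale (\<lambda>X. verma_act (Rep_nbar X)) (uea_incl (Abs_nbar (mode x_alpha m)) * u) verma_vac
      = ea m (uea_act verma_scale (\<lambda>X. verma_act (Rep_nbar X)) u verma_vac)" for u
    by (simp add: lie_module.uea_act_mult[OF nbar_lie_module] lie_module.uea_act_incl[OF nbar_lie_module])
  then show "v \<in> W_N \<Longrightarrow> ea m v \<in> W_N"
    unfolding W_N_iff by metis
qed

text \<open>This replaces induction over \<open>U(nbar)\<close>: every element of
  \<open>nbar\<close> is a finite sum of multiples of modes of \<open>x_alpha\<close>.\<close>

lemma W_N_least:
  assumes S: "vm.subspace S" and vac: "verma_vac \<in> S" and ea: "\<And>m v. v \<in> S \<Longrightarrow> ea m v \<in> S"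
  shows "W_N \<subseteq> S"
proof
  fix v
  assume "v \<in> W_N"
  then obtain u where v: "v = uea_act verma_scale (\<lambda>X. verma_act (Rep_nbar X)) u verma_vac"
    by (auto simp: W_N_iff)
  have nbar: "verma_act (Rep_nbar X) w \<in> S" if "w \<in> S" for X w
  proof -
    have "central_part (Rep_nbar X) = 0" and c: "\<exists>c. lookup (loop_part (Rep_nbar X)) m = lie_scale c x_alpha" for m
      using Rep_nbar[of X] by auto
    define g where "g k = lookup (loop_part (Rep_nbar X)) k" for k
    have "loop_part (Rep_nbar X) = (\<Sum>k\<in>keys (loop_part (Rep_nbar X)). single k (g k))"
      by (rule poly_mapping_eqI) (auto simp: g_def lookup_sum lookup_single when_def in_keys_iff)
    then have X: "Rep_nbar X = (\<Sum>k\<in>keys (loop_part (Rep_nbar X)). mode (g k) k)"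
      using \<open>central_part (Rep_nbar X) = 0\<close> by (intro affine.expand) (simp add: mode_def)
    have "verma_act (\<Sum>k\<in>B. mode (g k) k) w \<in> S" for B
    proof (induction B rule: infinite_finite_induct)
      case (insert k B)
      obtain c where "g k = lie_scale c x_alpha" using c[of k] by (auto simp: g_def)
      then have "verma_act (mode (g k) k) w \<in> S"
        using that by (simp add: mode_lie_scale vm.act_scale_left ea vm.subspace_scale[OF S])
      then show ?case using insert by (simp add: vm.act_add_left vm.subspace_add[OF S])
    qed (use vm.act_scale_left[of 0 0 w] vm.subspace_0[OF S] in auto)
    then show ?thesis by (metis X)
  qed
  have "foldr (\<lambda>X. verma_act (Rep_nbar X)) l verma_vac \<in> S" for l
    by (induction l) (auto simp: vac nbar)
  then show "v \<in> S"
    unfolding v uea_act_def free_act_def lin_ext_def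
    by (intro vm.subspace_sum[OF S] vm.subspace_scale[OF S])
qed

lemma W_N_eq_span: "W_N = vm.span (range (\<lambda>l. foldr (\<lambda>m. ea m) l verma_vac))" (is "_ = vm.span (range ?X)")
proof
  show "W_N \<subseteq> vm.span (range ?X)"
  proof (rule W_N_least)
    show "verma_vac \<in> vm.span (range ?X)"
      by (rule vm.span_base) (rule range_eqI[of _ _ "[]"], simp)
    show "ea m v \<in> vm.span (range ?X)" if "v \<in> vm.span (range ?X)" for m v
      using that
    proof (induction v rule: vm.span_induct_alt)
      case base
      then show ?case by (simp add: vm.span_zero)
    next
      case (step c x y)
      then obtain l where "x = ?X l" by auto
      then have "ea m x \<in> vm.span (range ?X)"
        by (intro vm.span_base range_eqI[of _ _ "m # l"]) simp
      then show ?case using step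
        by (simp add: vm.act_add_right vm.act_scale_right vm.span_add vm.span_scale)
    qed
  qed simp
  have "?X l \<in> W_N" for l
    by (induction l) (auto simp: W_N_vac W_N_ea)
  then show "vm.span (range ?X) \<subseteq> W_N"
    by (intro vm.span_minimal subspace_W_N) auto
qed

text \<open>The modes of \<open>x_alpha\<close> commute, so a nonnegative one can be moved to the
  vacuum, which it kills.\<close>

lemma ea_nonneg_W_N:
  assumes "v \<in> W_N" "m \<ge> 0"
  shows "ea m v = 0"
proof -
  have "W_N \<subseteq> {v. ea m v = 0}"
    using assms(2)
    by (intro W_N_least vm.subspaceI)
       (auto simp: verma_act_mode_vac ea_commute[of m] vm.act_add_right vm.act_scale_right)
  with assms(1) show ?thesis by auto
qed

section \<open>Mode formulas from the Jacobi identity\<close>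

context vertex_algebra
begin

lemma Sum_any_in_subspace: "subspace S \<Longrightarrow> (\<And>i. f i \<in> S) \<Longrightarrow> Sum_any f \<in> S"
  by (simp add: Sum_any.expand_set subspace_sum)

lemma Sum_any_eq_zeroth: "(\<And>i. i \<noteq> 0 \<Longrightarrow> f i = 0) \<Longrightarrow> Sum_any f = f (0::nat)"
  by (subst Sum_any.expand_superset[of "{0}"]) auto

lemma gbinomial_zero: "i \<noteq> 0 \<Longrightarrow> (0::complex) gchoose i = 0"
  by (cases i) simp_all

text \<open>This is the Jacobi identity at \<open>m = 0\<close>: on the left only the term
  \<open>i = 0\<close> has a nonzero binomial coefficient.\<close>

lemma iterate_formula:
  "Y (Y u l v) n w = Sum_any (\<lambda>i::nat. scale ((-1) ^ i * (of_int l gchoose i))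
     (Y u (l - int i) (Y v (n + int i) w)
       - scale ((-1) powi l) (Y v (n + l - int i) (Y u (int i) w))))"
  using jacobi[of 0 u l v n w]
  by (subst (asm) (1) Sum_any_eq_zeroth) (auto simp: gbinomial_zero)

text \<open>This is the Jacobi identity at \<open>l = 0\<close>, where the right side collapses to
  its term \<open>i = 0\<close>.\<close>

lemma commutator_formula:
  "Y u m (Y v n w) - Y v n (Y u m w) =
     Sum_any (\<lambda>i::nat. scale (of_int m gchoose i) (Y (Y u (int i) v) (m + n - int i) w))"
  using jacobi[of m u 0 v n w]
  by (subst (asm) (2) Sum_any_eq_zeroth) (auto simp: gbinomial_zero)

lemma iterate_closed:
  assumes S: "subspace S" and u: "\<And>n w. w \<in> S \<Longrightarrow> Y u n w \<in> S" and v: "\<And>n w. w \<in> S \<Longrightarrow> Y v n w \<in> S"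
    and w: "w \<in> S"
  shows "Y (Y u l v) n w \<in> S"
  unfolding iterate_formula
  by (intro Sum_any_in_subspace[OF S] subspace_scale[OF S] subspace_diff[OF S] u v w)

end

locale standard_voa =
  vertex_operator_algebra verma_scale Y verma_vac sugawara_vector 1
  for Y :: "verma \<Rightarrow> int \<Rightarrow> verma \<Rightarrow> verma" +
  assumes Y_generator: "Y (verma_act (mode a (-1)) verma_vac) m w = verma_act (mode a m) w"
begin

text \<open>Since \<open>ea m v\<close> is the \<open>m\<close>-th product of
  \<open>ea (-1) verma_vac\<close> with \<open>v\<close>, \<open>iterate_closed\<close> passes
  stability of \<open>W_N\<close> from \<open>v\<close> to \<open>ea m v\<close>.\<close>

lemma W_N_subalgebra: "vertex_subalgebra W_N"
proof -
  have "W_N \<subseteq> {v \<in> W_N. \<forall>n. \<forall>w\<in>W_N. Y v n w \<in> W_N}" (is "_ \<subseteq> ?S")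
  proof (rule W_N_least)
    show "subspace ?S"
      using subspace_W_N unfolding subspace_def
      by (auto simp: Y_add_left Y_scale_left) (metis Y_scale_left scale_zero_left)
    show "verma_vac \<in> ?S"
      using subspace_0[OF subspace_W_N] by (auto simp: W_N_vac vacuum)
    show "ea m v \<in> ?S" if "v \<in> ?S" for m v
    proof -
      have "Y (Y (ea (-1) verma_vac) m v) n w \<in> W_N" if "w \<in> W_N" for n w
        using \<open>v \<in> ?S\<close> that by (intro iterate_closed[OF subspace_W_N]) (auto simp: Y_generator W_N_ea)
      then show ?thesis using that by (auto simp: Y_generator W_N_ea)
    qed
  qed
  then show ?thesis
    by (auto simp: vertex_subalgebra_def subspace_W_N W_N_vac)
qed

lemma submodule_mode_left:
  assumes K: "vm.submodule K" and w: "w \<in> K"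
  shows "Y v n w \<in> K"
proof -
  from K have S: "subspace K" and act: "\<And>X w. w \<in> K \<Longrightarrow> verma_act X w \<in> K"
    by (auto simp: vm.submodule_def)
  have "\<forall>n. \<forall>w\<in>K. Y v n w \<in> K"
  proof (induction v rule: verma_mode_induct)
    case vac
    show ?case using subspace_0[OF S] by (auto simp: vacuum)
  next
    case (mode a m v)
    have "Y (Y (verma_act (mode a (-1)) verma_vac) m v) n w \<in> K" if "w \<in> K" for n w
      using that mode by (intro iterate_closed[OF S]) (auto simp: Y_generator act)
    then show ?case by (simp add: Y_generator)
  qed (auto simp: Y_add_left Y_scale_left subspace_add[OF S] subspace_scale[OF S])
  with w show ?thesis by blast
qed

text \<open>Induction on \<open>w\<close>. On the vacuum, negative modes of \<open>v\<close> arise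
  up to nonzero factors by iterating the derivation \<open>Y sugawara_vector 0\<close>, which
  preserves \<open>K\<close>. The commutator formula then moves a generating mode to the
  front.\<close>

lemma submodule_mode_right:
  assumes K: "vm.submodule K" and v: "v \<in> K"
  shows "Y v n w \<in> K"
proof -
  from K have S: "subspace K" and act: "\<And>X w. w \<in> K \<Longrightarrow> verma_act X w \<in> K"
    by (auto simp: vm.submodule_def)
  have creation_neg: "\<forall>v\<in>K. Y v (- 1 - int k) verma_vac \<in> K" for k
  proof (induction k)
    case 0
    then show ?case by (simp add: creation)
  next
    case (Suc k)
    show ?case
    proof
      fix v
      assume "v \<in> K"
      then have "Y sugawara_vector 0 v \<in> K" by (rule submodule_mode_left[OF K])
      with Suc have "Y (Y sugawara_vector 0 v) (- 1 - int k) verma_vac \<in> K" by blast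
      moreover have "(- of_int (- 1 - int k) :: complex) = of_int (1 + int k)" by simp
      ultimately have "verma_scale (of_int (1 + int k)) (Y v (- 1 - int k - 1) verma_vac) \<in> K"
        by (metis derivative)
      then have "verma_scale (inverse (of_int (1 + int k)))
          (verma_scale (of_int (1 + int k)) (Y v (- 1 - int k - 1) verma_vac)) \<in> K"
        by (rule subspace_scale[OF S])
      moreover have "(of_int (1 + int k) :: complex) \<noteq> 0"
        by (simp only: of_int_eq_0_iff)
      moreover have "- 1 - int k - 1 = - 1 - int (Suc k)" by simp
      ultimately show "Y v (- 1 - int (Suc k)) verma_vac \<in> K"
        by (metis scale_scale left_inverse scale_one)
    qed
  qed
  have "\<forall>n. \<forall>v\<in>K. Y v n w \<in> K"
  proof (induction w rule: verma_mode_induct)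
    case vac
    show ?case
    proof (intro allI ballI)
      fix n v
      assume "v \<in> K"
      show "Y v n verma_vac \<in> K"
      proof (cases "n \<ge> 0")
        case True
        then show ?thesis by (simp add: creation subspace_0[OF S])
      next
        case False
        then have "n = - 1 - int (nat (- 1 - n))" by simp
        then show ?thesis using creation_neg \<open>v \<in> K\<close> by metis
      qed
    qed
  next
    case (mode a m w)
    show ?case
    proof (intro allI ballI)
      fix n v
      assume v: "v \<in> K"
      have *: "Y v n (verma_act (mode a m) w) = verma_act (mode a m) (Y v n w)
          - Sum_any (\<lambda>i::nat. verma_scale (of_int m gchoose i)
              (Y (verma_act (mode a (int i)) v) (m + n - int i) w))"
        using commutator_formula[of "verma_act (mode a (-1)) verma_vac" m v n w]
        by (simp add: Y_generator algebra_simps)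
      show "Y v n (verma_act (mode a m) w) \<in> K"
        unfolding *
        using mode v by (intro subspace_diff[OF S] act Sum_any_in_subspace[OF S] subspace_scale[OF S]) (auto intro: act)
    qed
  qed (auto simp: Y_add_right Y_scale_right subspace_add[OF S] subspace_scale[OF S])
  with v show ?thesis by blast
qed

lemma submodule_va_ideal: "vm.submodule K \<Longrightarrow> va_ideal UNIV K"
  by (auto simp: va_ideal_def submodule_mode_left submodule_mode_right vm.submodule_def)

end


section \<open>The singular vector\<close>

context vector_space
begin

text \<open>Applying \<open>T\<close> minus the eigenvalue of one summand kills that summand and
  rescales the others by nonzero factors; the induction hypothesis then applies to the rest.\<close>

lemma eigenvectors_in_subspace:
  assumes K: "subspace K" and stable: "\<And>u. u \<in> K \<Longrightarrow> T u \<in> K"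
    and add: "\<And>u v. T (u + v) = T u + T v" and scale: "\<And>c u. T (scale c u) = scale c (T u)"
    and A: "finite A" "inj_on \<mu> A"
    and eigen: "\<And>i. i \<in> A \<Longrightarrow> T (g i) = scale (\<mu> i) (g i)"
    and sum: "sum g A \<in> K" and i: "i \<in> A"
  shows "g i \<in> K"
  using A eigen sum i
proof (induction A arbitrary: g i)
  case (insert a A)
  have T0: "T 0 = 0" using scale[of 0 0] by simp
  have T_sum: "T (sum f B) = (\<Sum>b\<in>B. T (f b))" for f and B :: "'i set"
    by (induction B rule: infinite_finite_induct) (simp_all add: T0 add)
  define f where "f j = scale (\<mu> j - \<mu> a) (g j)" for j
  have "T (sum g (insert a A)) - scale (\<mu> a) (sum g (insert a A)) \<in> K"
    by (intro subspace_diff[OF K] stable subspace_scale[OF K] insert.prems)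
  also have "T (sum g (insert a A)) - scale (\<mu> a) (sum g (insert a A))
      = (\<Sum>j\<in>A. T (g j) - scale (\<mu> a) (g j))"
    using insert.hyps insert.prems(2)[of a]
    by (simp add: T_sum add scale_right_distrib scale_sum_right sum_subtractf)
  also have "\<dots> = sum f A"
    using insert.prems(2) by (intro sum.cong) (auto simp: f_def scale_left_diff_distrib)
  finally have "sum f A \<in> K" .
  moreover have "T (f j) = scale (\<mu> j) (f j)" if "j \<in> A" for j
    using insert.prems(2)[of j] that by (simp add: f_def scale mult.commute)
  ultimately have f: "f j \<in> K" if "j \<in> A" for j
    using insert.IH[of f j] insert.prems(1) that by auto
  have g: "g j \<in> K" if "j \<in> A" for j
  proof -
    have "\<mu> j - \<mu> a \<noteq> 0"
      using inj_onD[OF insert.prems(1), of j a] insert.hyps(2) that by auto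
    then have "g j = scale (inverse (\<mu> j - \<mu> a)) (f j)" by (simp add: f_def)
    then show ?thesis by (simp add: f[OF that] subspace_scale[OF K])
  qed
  moreover have "g a \<in> K"
  proof -
    have "g a = sum g (insert a A) - sum g A" using insert.hyps by simp
    then show ?thesis
      using subspace_diff[OF K insert.prems(3) subspace_sum[OF K g]] by simp
  qed
  ultimately show ?case using insert.prems(4) by auto
qed simp

lemma eigenvector_in_subspace:
  assumes K: "subspace K" and stable: "\<And>u. u \<in> K \<Longrightarrow> T u \<in> K"
    and add: "\<And>u v. T (u + v) = T u + T v" and scale: "\<And>c u. T (scale c u) = scale c (T u)"
    and v: "T v = scale \<mu>\<^sub>0 v" and f: "f \<in> span E"
    and E: "\<And>e. e \<in> E \<Longrightarrow> \<exists>\<mu>. \<mu> \<noteq> \<mu>\<^sub>0 \<and> T e = scale \<mu> e"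
    and diff: "v - f \<in> K"
  shows "v \<in> K"
proof -
  obtain t r where t: "finite t" "t \<subseteq> E" and f_eq: "f = (\<Sum>a\<in>t. scale (r a) a)"
    using f by (auto simp: span_explicit)
  obtain \<mu> where \<mu>: "\<And>e. e \<in> E \<Longrightarrow> \<mu> e \<noteq> \<mu>\<^sub>0 \<and> T e = scale (\<mu> e) e"
    using E by metis
  have T0: "T 0 = 0" using scale[of 0 0] by simp
  have T_sum: "T (sum h B) = (\<Sum>b\<in>B. T (h b))" for h and B :: "'b set"
    by (induction B rule: infinite_finite_induct) (simp_all add: T0 add)
  \<comment> \<open>\<open>g k\<close> is the component of \<open>v - f\<close> of eigenvalue
    \<open>k\<close>; no part of \<open>f\<close> has eigenvalue \<open>\<mu>\<^sub>0\<close>, so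
    \<open>v\<close> is a full component.\<close>
  define g where "g k = (if k = \<mu>\<^sub>0 then v else - (\<Sum>a\<in>{a\<in>t. \<mu> a = k}. scale (r a) a))" for k
  have "f = (\<Sum>k\<in>\<mu> ` t. \<Sum>a\<in>{a\<in>t. \<mu> a = k}. scale (r a) a)"
    unfolding f_eq by (rule sum.image_gen[OF t(1)])
  moreover have \<mu>\<^sub>0: "\<mu>\<^sub>0 \<notin> \<mu> ` t" using \<mu> t(2) by blast
  then have "(\<Sum>k\<in>\<mu> ` t. g k) = (\<Sum>k\<in>\<mu> ` t. - (\<Sum>a\<in>{a\<in>t. \<mu> a = k}. scale (r a) a))"
    unfolding g_def by (intro sum.cong if_not_P refl) blast
  ultimately have "sum g (insert \<mu>\<^sub>0 (\<mu> ` t)) = v - f"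
    using t(1) \<mu>\<^sub>0 by (simp add: sum_negf g_def[of \<mu>\<^sub>0])
  moreover have "T (g k) = scale k (g k)" if "k \<in> insert \<mu>\<^sub>0 (\<mu> ` t)" for k
  proof (cases "k = \<mu>\<^sub>0")
    case False
    have neg: "T (- u) = - T u" for u using scale[of "-1" u] by simp
    have "(\<Sum>a\<in>{a\<in>t. \<mu> a = k}. T (scale (r a) a)) = scale k (\<Sum>a\<in>{a\<in>t. \<mu> a = k}. scale (r a) a)"
      using \<mu> t(2) unfolding scale_sum_right
      by (intro sum.cong) (auto simp: scale mult.commute)
    then show ?thesis using False by (simp add: g_def neg T_sum)
  qed (simp add: g_def v)
  ultimately have "g \<mu>\<^sub>0 \<in> K"
    using eigenvectors_in_subspace[where T = T and A = "insert \<mu>\<^sub>0 (\<mu> ` t)" and \<mu> = "\<lambda>k. k" and g = g,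
        OF K stable add scale] t(1) diff by (metis finite_imageI finite_insert inj_on_id2 insertI1)
  then show ?thesis by (simp add: g_def)
qed

end

section \<open>Positive modes on the Sugawara vector and on the singular vector\<close>

lemma verma_scale_two: "verma_scale 2 v = v + v"
  using vm.scale_left_distrib[of 1 1 v] by simp

text \<open>Oriented for rewriting: in vectors built from modes of index -1, the other modes travel
  right until they reach the vacuum.\<close>

lemma past_minus_one:
  assumes "m \<ge> 0"
  shows "ea m (fa (-1) v) = fa (-1) (ea m v) + ha (m - 1) v + verma_scale (if m = 1 then 1 else 0) v"
    and "ea m (ha (-1) v) = ha (-1) (ea m v) - verma_scale 2 (ea (m - 1) v)"
    and "ea m (ea (-1) v) = ea (-1) (ea m v)"
    and "ha m (fa (-1) v) = fa (-1) (ha m v) - verma_scale 2 (fa (m - 1) v)"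
    and "ha m (ha (-1) v) = ha (-1) (ha m v) + verma_scale (if m = 1 then 2 else 0) v"
    and "ha m (ea (-1) v) = ea (-1) (ha m v) + verma_scale 2 (ea (m - 1) v)"
    and "fa m (fa (-1) v) = fa (-1) (fa m v)"
    and "fa m (ha (-1) v) = ha (-1) (fa m v) + verma_scale 2 (fa (m - 1) v)"
    and "fa m (ea (-1) v) = ea (-1) (fa m v) - ha (m - 1) v + verma_scale (if m = 1 then 1 else 0) v"
  by (simp_all add: verma_act_mode_swap[of x_alpha m] verma_act_mode_swap[of h_elt m]
      verma_act_mode_swap[of x_minus_alpha m] sl2_relations lie_bracket_basis lie_bracket_self
      trace_form_basis mode_lie_scale vm.act_scale_left mode_zero)

lemma sl2_basis_cases:
  assumes "\<And>b. b \<in> {x_alpha, h_elt, x_minus_alpha} \<Longrightarrow> P b"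
    and "\<And>c b. P b \<Longrightarrow> P (lie_scale c b)" and "\<And>b c. P b \<Longrightarrow> P c \<Longrightarrow> P (b + c)"
  shows "P (a :: sl2)"
  using sl2_span[of a] assms by auto

text \<open>This product fixes the conformal weight 1 of the generators. Both sides are linear in
  \<open>a\<close>, so the three basis elements suffice.\<close>

lemma sugawara_mode_one: "verma_act (mode a 1) sugawara_vector = verma_act (mode a (-1)) verma_vac"
proof (induction a rule: sl2_basis_cases)
  case (1 b)
  have six: "verma_scale 6 v = v + v + (v + v) + (v + v)" for v
    unfolding verma_scale_two[symmetric] by (simp flip: vm.scale_left_distrib)
  have half: "verma_scale (1 / 2) v + verma_scale (1 / 2) v = v" for v
    by (simp flip: vm.scale_left_distrib)
  \<comment> \<open>The factor 6 is cancelled by the prefactor \<open>1 / (2 * (1 + 2))\<close> of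
    the Sugawara vector.\<close>
  have "verma_act (mode b 1)
      (ea (-1) (fa (-1) verma_vac) + fa (-1) (ea (-1) verma_vac)
        + ha (-1) (verma_act (mode (lie_scale (1/2) h_elt) (-1)) verma_vac))
      = verma_scale 6 (verma_act (mode b (-1)) verma_vac)"
    using 1 unfolding six
    by (auto simp: half vm.act_scale_right vm.act_add_right vm.act_minus_right mode_lie_scale
        vm.act_scale_left past_minus_one verma_act_mode_vac verma_scale_two vm.scale_right_distrib)
  then show ?case by (simp add: sugawara_vector_def vm.act_scale_right)
qed (simp_all add: mode_lie_scale mode_add vm.act_scale_left vm.act_add_left)

lemma sugawara_mode_ge_two: "m \<ge> 2 \<Longrightarrow> verma_act (mode a m) sugawara_vector = 0"
proof (induction a rule: sl2_basis_cases)
  case (1 b)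
  then show ?case
    by (auto simp: sugawara_vector_def vm.act_scale_right vm.act_add_right vm.act_minus_right mode_lie_scale
        vm.act_scale_left past_minus_one verma_act_mode_vac)
qed (simp_all add: mode_lie_scale mode_add vm.act_scale_left vm.act_add_left)

text \<open>Level 1 enters in the case \<open>fa 1\<close>: there \<open>- ha 0\<close> contributes
  -2 times \<open>ea (-1) verma_vac\<close>, and the two central terms contribute 1 each.\<close>

lemma x_alpha_squared_singular: "m > 0 \<Longrightarrow> verma_act (mode a m) x_alpha_squared_vac = 0"
proof (induction a rule: sl2_basis_cases)
  case (1 b)
  then show ?case
    by (auto simp: x_alpha_squared_vac_def vm.act_scale_right vm.act_add_right vm.act_minus_right
        past_minus_one verma_act_mode_vac verma_scale_two)
qed (simp_all add: mode_lie_scale mode_add vm.act_scale_left vm.act_add_left)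

section \<open>Conformal weights of the modes\<close>

context standard_voa
begin

text \<open>In the commutator with the Sugawara field only the product of index \<open>i = 1\<close>
  survives: creation removes \<open>i = 0\<close>, and \<open>sugawara_mode_ge_two\<close> removes
  the rest.\<close>

lemma L0_generator:
  "Y sugawara_vector 1 (verma_act (mode a (-1)) verma_vac) = verma_act (mode a (-1)) verma_vac"
proof -
  let ?a = "verma_act (mode a (-1)) verma_vac"
  let ?f = "\<lambda>i::nat. verma_scale (of_int (-1) gchoose i) (Y (Y ?a (int i) sugawara_vector) (- int i) verma_vac)"
  have "?f i = 0" if "i \<noteq> 1" for i
    using that by (cases "i = 0") (simp_all add: creation Y_generator sugawara_mode_ge_two Y_scale_left[of 0 0, simplified])
  then have "Sum_any ?f = ?f 1"
    by (subst Sum_any.expand_superset[of "{1}"]) auto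
  then show ?thesis
    using commutator_formula[of ?a "-1" sugawara_vector 1 verma_vac]
    by (simp add: Y_generator creation sugawara_mode_one)
qed

text \<open>The products of index 0 and 1 of the conformal vector with the generator are its
  derivative and its weight; they contribute \<open>- (1 + n)\<close> and 1.\<close>

lemma L0_mode:
  "Y sugawara_vector 1 (verma_act (mode a n) w) =
    verma_act (mode a n) (Y sugawara_vector 1 w) - verma_scale (of_int n) (verma_act (mode a n) w)"
proof -
  let ?a = "verma_act (mode a (-1)) verma_vac"
  let ?f = "\<lambda>i::nat. verma_scale (of_int 1 gchoose i) (Y (Y sugawara_vector (int i) ?a) (1 + n - int i) w)"
  have "?f i = 0" if "i \<noteq> 0" "i \<noteq> 1" for i
  proof -
    have "(of_int 1 gchoose i :: complex) = of_nat (1 choose i)"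
      by (simp add: binomial_gbinomial)
    then show ?thesis using that by simp
  qed
  then have "Sum_any ?f = ?f 0 + ?f 1"
    by (subst Sum_any.expand_superset[of "{0, 1}"]) auto
  then have "Y sugawara_vector 1 (Y ?a n w) - Y ?a n (Y sugawara_vector 1 w) =
      verma_scale (- of_int (1 + n)) (verma_act (mode a n) w) + verma_act (mode a n) w"
    using commutator_formula[of sugawara_vector 1 ?a n w]
    by (simp add: L0_generator derivative Y_generator)
  then show ?thesis
    by (simp add: Y_generator algebra_simps)
qed

end

text \<open>Since positive modes kill the singular vector, the span of these words is a submodule.\<close>

inductive_set singular_words :: "verma set" where
  base: "x_alpha_squared_vac \<in> singular_words"
| step: "v \<in> singular_words \<Longrightarrow> m \<le> 0 \<Longrightarrow> verma_act (mode a m) v \<in> singular_words"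

lemma span_singular_words_nonpos:
  assumes "m \<le> 0" "v \<in> vm.span singular_words"
  shows "verma_act (mode a m) v \<in> vm.span singular_words"
  using assms(2)
proof (induction v rule: vm.span_induct_alt)
  case base
  then show ?case by (simp add: vm.span_zero)
next
  case (step c x y)
  with assms(1) have "verma_act (mode a m) x \<in> vm.span singular_words"
    by (intro vm.span_base singular_words.step)
  then show ?case using step
    by (simp add: vm.act_add_right vm.act_scale_right vm.span_add vm.span_scale)
qed

text \<open>A mode of any index is commuted inward through the word to the singular vector; the
  bracket and central corrections involve only the shorter word, so the induction hypothesis covers
  them.\<close>

lemma singular_words_mode: "v \<in> singular_words \<Longrightarrow> verma_act (mode a m) v \<in> vm.span singular_words"
proof (induction v arbitrary: a m rule: singular_words.induct)
  case base
  then show ?case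
    by (cases "m > 0") (simp_all add: x_alpha_squared_singular vm.span_zero vm.span_base singular_words.intros)
next
  case (step v n b)
  have "verma_act (mode b n) (verma_act (mode a m) v)
      + verma_act (mode (lie_bracket a b) (m + n)) v
      + verma_scale (if m + n = 0 then of_int m * trace_form a b else 0) v \<in> vm.span singular_words"
    by (rule vm.span_add[OF vm.span_add[OF span_singular_words_nonpos[OF step.hyps(2) step.IH] step.IH]
          vm.span_scale[OF vm.span_base[OF step.hyps(1)]]])
  then show ?case
    by (simp only: verma_act_mode_swap[of a m b n])
qed

lemma submodule_singular_words: "vm.submodule (vm.span singular_words)"
proof -
  have mode: "verma_act (mode a m) v \<in> vm.span singular_words" if "v \<in> vm.span singular_words" for a m v
    using that
    by (induction v rule: vm.span_induct_alt)
       (simp_all add: vm.act_add_right vm.act_scale_right vm.span_add vm.span_scale vm.span_zero singular_words_mode)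
  have "verma_act X v \<in> vm.span singular_words" if "v \<in> vm.span singular_words" for X v
    using that
    by (induction X rule: affine_induct) (simp_all add: mode vm.act_add_left vm.span_add vm.span_scale)
  then show ?thesis by (simp add: vm.submodule_def)
qed

context standard_voa
begin

text \<open>Nonpositive modes never lower the weight, so all words keep weight at least 2, away from
  the weight 0 of the vacuum.\<close>

lemma singular_words_weight:
  "v \<in> singular_words \<Longrightarrow> \<exists>k::nat. k \<ge> 2 \<and> Y sugawara_vector 1 v = verma_scale (of_nat k) v"
proof (induction v rule: singular_words.induct)
  case base
  have "Y sugawara_vector 1 x_alpha_squared_vac = verma_scale (of_nat 2) x_alpha_squared_vac"
    unfolding x_alpha_squared_vac_def L0_mode[of x_alpha "-1" "ea (-1) verma_vac"] L0_generator
    by (simp add: verma_scale_two)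
  then show ?case by blast
next
  case (step v m a)
  then obtain k :: nat where k: "k \<ge> 2" "Y sugawara_vector 1 v = verma_scale (of_nat k) v" by blast
  have "(of_nat (k + nat (- m)) :: complex) = of_nat k - of_int m"
    using step by simp
  then have "Y sugawara_vector 1 (verma_act (mode a m) v) = verma_scale (of_nat (k + nat (- m))) (verma_act (mode a m) v)"
    by (simp only: L0_mode k vm.act_scale_right scale_left_diff_distrib)
  then show ?case using k(1) by (metis trans_le_add1)
qed

text \<open>The image of the submodule of singular words is zero or everything by irreducibility. In
  the second case some \<open>f\<close> of that submodule has the image of the vacuum, and
  separating weights modulo the kernel forces \<open>vL = 0\<close>.\<close>

lemma x_alpha_squared_in_kernel:
  assumes L: "standard_module_\<Lambda>0 scaleL actL vL"
    and hom: "lie_module_hom verma_scale verma_act scaleL actL proj" and vac: "proj verma_vac = vL"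
  shows "vm.submodule {v. proj v = 0}" and "proj x_alpha_squared_vac = 0"
proof -
  interpret L: lie_module scaleL actL
    using L by (simp add: standard_module_\<Lambda>0_def highest_weight_module_\<Lambda>0_def)
  interpret proj: Vector_Spaces.linear verma_scale scaleL proj
    using hom by (simp add: lie_module_hom_def)
  have proj_act: "proj (verma_act X v) = actL X (proj v)" for X v
    using hom by (simp add: lie_module_hom_def)
  show K: "vm.submodule {v. proj v = 0}"
    unfolding vm.submodule_def
    by (auto simp: proj_act proj.add proj.scale proj.zero intro!: subspaceI)
  let ?U = "proj ` vm.span singular_words"
  have "L.submodule ?U"
    using submodule_singular_words
    unfolding L.submodule_def vm.submodule_def
    by (auto intro: proj.subspace_image) (metis imageI proj_act)
  then consider "?U = {0}" | "?U = UNIV"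
    using L by (auto simp: standard_module_\<Lambda>0_def L.irreducible_module_def)
  then show "proj x_alpha_squared_vac = 0"
  proof cases
    case 1
    then show ?thesis using vm.span_base[OF singular_words.base] by blast
  next
    case 2
    then obtain f where f: "f \<in> vm.span singular_words" "proj f = vL" by (metis UNIV_I imageE)
    have "verma_vac \<in> {v. proj v = 0}"
    proof (rule eigenvector_in_subspace[where T = "Y sugawara_vector 1" and \<mu>\<^sub>0 = 0, OF _ _ Y_add_right Y_scale_right _ f(1)])
      show "subspace {v. proj v = 0}" using K by (simp add: vm.submodule_def)
      show "Y sugawara_vector 1 u \<in> {v. proj v = 0}" if "u \<in> {v. proj v = 0}" for u
        using submodule_mode_left[OF K that] .
      show "Y sugawara_vector 1 verma_vac = verma_scale 0 verma_vac" by (simp add: creation)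
      show "\<exists>\<mu>. \<mu> \<noteq> 0 \<and> Y sugawara_vector 1 e = verma_scale \<mu> e" if "e \<in> singular_words" for e
        using singular_words_weight[OF that] by (metis not_numeral_le_zero of_nat_eq_0_iff)
      show "verma_vac - f \<in> {v. proj v = 0}" by (simp add: proj.diff vac f)
    qed
    moreover have "vL \<noteq> 0"
      using L by (simp add: standard_module_\<Lambda>0_def highest_weight_module_\<Lambda>0_def)
    ultimately show ?thesis by (simp add: vac)
  qed
qed

end


section \<open>Elementary symmetric operators and extremal vectors\<close>

text \<open>Newton's recursion \<open>r E\<^sub>r = \<Sum>\<^bsub>i=1..r\<^esub> (-1)\<^bsup>i-1\<^esup> E\<^bsub>r-i\<^esub> p\<^sub>i\<close> with \<open>h(i)/2\<close> in the role of the power sum \<open>p\<^sub>i\<close>.\<close>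

fun elem_op :: "nat \<Rightarrow> verma \<Rightarrow> verma" where
  "elem_op 0 v = v"
| "elem_op (Suc r) v = verma_scale (1 / of_nat (Suc r))
    (\<Sum>i\<le>r. verma_scale ((-1) ^ i / 2) (elem_op (r - i) (ha (int i + 1) v)))"

declare elem_op.simps(2) [simp del]

lemma elem_op_add: "elem_op r (u + v) = elem_op r u + elem_op r v"
proof (induction r arbitrary: u v rule: less_induct)
  case (less r)
  show ?case
  proof (cases r)
    case (Suc s)
    have "elem_op (s - i) (ha (int i + 1) (u + v)) =
        elem_op (s - i) (ha (int i + 1) u) + elem_op (s - i) (ha (int i + 1) v)" for i
      using less[of "s - i"] Suc by (simp add: vm.act_add_right)
    then show ?thesis
      by (simp add: Suc elem_op.simps(2) vm.scale_right_distrib sum.distrib)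
  qed simp
qed

lemma elem_op_scale: "elem_op r (verma_scale c v) = verma_scale c (elem_op r v)"
proof (induction r arbitrary: v rule: less_induct)
  case (less r)
  show ?case
  proof (cases r)
    case (Suc s)
    have "elem_op (s - i) (ha (int i + 1) (verma_scale c v)) =
        verma_scale c (elem_op (s - i) (ha (int i + 1) v))" for i
      using less[of "s - i"] Suc by (simp add: vm.act_scale_right)
    then show ?thesis
      by (simp add: Suc elem_op.simps(2) vm.scale_sum_right mult.commute)
  qed simp
qed

lemma elem_op_zero: "elem_op r 0 = 0"
  using elem_op_scale[of r 0 0] by simp

lemma elem_op_sum: "elem_op r (sum f A) = (\<Sum>a\<in>A. elem_op r (f a))"
  by (induction A rule: infinite_finite_induct) (simp_all add: elem_op_add elem_op_zero)

lemma elem_op_Suc_vac: "elem_op (Suc r) verma_vac = 0"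
  by (simp add: elem_op.simps(2) verma_act_mode_vac elem_op_zero)

lemma elem_op_submodule:
  assumes "vm.submodule K" "v \<in> K"
  shows "elem_op r v \<in> K"
  using assms(2)
proof (induction r arbitrary: v rule: less_induct)
  case (less r)
  show ?case
  proof (cases r)
    case 0
    then show ?thesis using less.prems by simp
  next
    case (Suc s)
    have "elem_op (s - i) (ha (int i + 1) v) \<in> K" for i
      using less.IH[of "s - i"] less.prems assms(1) Suc by (auto simp: vm.submodule_def)
    then show ?thesis
      using assms(1) unfolding Suc elem_op.simps(2) vm.submodule_def
      by (intro vm.subspace_scale vm.subspace_sum) auto
  qed
qed

text \<open>Adjoining a variable \<open>x\<close> multiplies the generating function of the
  elementary symmetric polynomials by \<open>1 + t x\<close>; here \<open>x\<close> shifts the new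
  factor. The proof goes through Newton's recursion.\<close>

lemma elem_op_ea:
  "elem_op r (ea m v) = ea m (elem_op r v) + ea (m + 1) (if r = 0 then 0 else elem_op (r - 1) v)"
proof (induction r arbitrary: m v rule: less_induct)
  case (less r)
  show ?case
  proof (cases r)
    case (Suc s)
    let ?P = "\<lambda>r u. if r = 0 then 0 else elem_op (r - 1) u"
    \<comment> \<open>\<open>D i\<close> plays the power sum of degree \<open>i + 1\<close>: passing
      a factor, it adds a term with that factor shifted by \<open>i + 1\<close>.\<close>
    define D where "D i u = verma_scale (1 / 2) (ha (int i + 1) u)" for i u
    \<comment> \<open>Shifting the new factor by \<open>i + 1\<close> in one term of the recursion
      cancels against the next term, so these contributions telescope; the cutoff at
      \<open>s\<close> ends the sum.\<close>
    define g where "g i = (if i \<le> s then verma_scale ((-1) ^ i) (ea (m + 1 + int i) (elem_op (s - i) v)) else 0)" for i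
    have E: "elem_op (Suc t) u = verma_scale (1 / of_nat (Suc t)) (\<Sum>i\<le>t. verma_scale ((-1) ^ i) (elem_op (t - i) (D i u)))" for t u
      by (simp add: elem_op.simps(2) D_def elem_op_scale)
    have E': "(\<Sum>i\<le>t. verma_scale ((-1) ^ i) (elem_op (t - i) (D i u))) = verma_scale (of_nat (Suc t)) (elem_op (Suc t) u)" for t u
      unfolding E by (simp del: of_nat_Suc)
    have D_ea: "D i (ea m u) = ea m (D i u) + ea (m + 1 + int i) u" for i u
      by (simp add: D_def ha_ea vm.scale_right_distrib vm.act_scale_right algebra_simps)
    have summand: "verma_scale ((-1) ^ i) (elem_op (s - i) (D i (ea m v))) =
        verma_scale ((-1) ^ i) (ea m (elem_op (s - i) (D i v)))
        + verma_scale ((-1) ^ i) (ea (m + 1) (?P (s - i) (D i v)))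
        + (g i - g (Suc i))" if "i \<le> s" for i
    proof -
      have "s - i < r" using Suc by simp
      note IH = less[OF this]
      have "- g (Suc i) = verma_scale ((-1) ^ i) (ea (m + 1 + int i + 1) (?P (s - i) v))"
        using that by (simp add: g_def algebra_simps)
      then show ?thesis
        using that unfolding D_ea elem_op_add IH
        by (simp add: g_def vm.scale_right_distrib)
    qed
    have g: "(\<Sum>i\<le>s. g i - g (Suc i)) = ea (m + 1) (elem_op s v)"
      unfolding sum_telescope by (simp add: g_def)
    \<comment> \<open>Newton's recursion one degree lower gives \<open>s\<close> copies; the
      telescoped sum supplies the missing one of \<open>Suc s\<close>.\<close>
    have P: "(\<Sum>i\<le>s. verma_scale ((-1) ^ i) (?P (s - i) (D i v))) = verma_scale (of_nat s) (elem_op s v)"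
    proof (cases s)
      case (Suc t)
      have "(\<Sum>i\<le>s. verma_scale ((-1) ^ i) (?P (s - i) (D i v))) =
          (\<Sum>i\<le>t. verma_scale ((-1) ^ i) (elem_op (t - i) (D i v)))"
        by (simp add: Suc Suc_diff_le)
      then show ?thesis by (simp only: E' Suc)
    qed simp
    have "verma_scale (of_nat (Suc s)) (elem_op (Suc s) (ea m v)) =
        (\<Sum>i\<le>s. verma_scale ((-1) ^ i) (elem_op (s - i) (D i (ea m v))))"
      by (simp only: E')
    also have "\<dots> = (\<Sum>i\<le>s. verma_scale ((-1) ^ i) (ea m (elem_op (s - i) (D i v)))
        + verma_scale ((-1) ^ i) (ea (m + 1) (?P (s - i) (D i v)))
        + (g i - g (Suc i)))"
      by (intro sum.cong refl summand) simp
    also have "\<dots> = ea m (\<Sum>i\<le>s. verma_scale ((-1) ^ i) (elem_op (s - i) (D i v)))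
        + ea (m + 1) (\<Sum>i\<le>s. verma_scale ((-1) ^ i) (?P (s - i) (D i v))) + ea (m + 1) (elem_op s v)"
      by (simp only: sum.distrib g vm.act_sum_right vm.act_scale_right)
    also have "\<dots> = verma_scale (of_nat (Suc s)) (ea m (elem_op (Suc s) v) + ea (m + 1) (elem_op s v))"
      unfolding P E' by (simp add: vm.act_scale_right vm.act_add_right vm.scale_right_distrib vm.scale_left_distrib)
    finally show ?thesis
      unfolding Suc by (simp del: of_nat_Suc)
  qed simp
qed

lemma elem_op_Suc_ea: "elem_op (Suc r) (ea m v) = ea m (elem_op (Suc r) v) + ea (m + 1) (elem_op r v)"
  by (simp add: elem_op_ea)

text \<open>Entries are negated mode indices, so a monomial on the vacuum vanishes unless all its
  entries are positive.\<close>

definition monomial :: "int list \<Rightarrow> verma \<Rightarrow> verma"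
  where "monomial l v = foldr (\<lambda>m. ea (- m)) l v"

lemma monomial_simps [simp]:
  "monomial [] v = v"
  "monomial (m # l) v = ea (- m) (monomial l v)"
  "monomial (k @ l) v = monomial k (monomial l v)"
  by (simp_all add: monomial_def)

lemma monomial_add: "monomial l (u + v) = monomial l u + monomial l v"
  by (induction l) (simp_all add: vm.act_add_right)

lemma monomial_scale: "monomial l (verma_scale c v) = verma_scale c (monomial l v)"
  by (induction l) (simp_all add: vm.act_scale_right)

lemma monomial_zero: "monomial l 0 = 0"
  by (induction l) simp_all

lemma monomial_W_N: "v \<in> W_N \<Longrightarrow> monomial l v \<in> W_N"
  by (induction l) (simp_all add: W_N_ea)

lemma monomial_permute: "mset k = mset l \<Longrightarrow> monomial k v = monomial l v"
proof -
  assume "mset k = mset l"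
  then have "fold (\<lambda>m. ea (- m)) (rev k) = fold (\<lambda>m. ea (- m)) (rev l)"
    by (intro fold_multiset_equiv) (auto simp: ea_commute)
  then show ?thesis by (simp add: monomial_def foldr_conv_fold)
qed

lemma ha_0_monomial: "ha 0 (monomial l verma_vac) = verma_scale (of_nat (2 * length l)) (monomial l verma_vac)"
  by (induction l) (simp_all add: verma_act_mode_vac ha_ea vm.act_scale_right vm.scale_left_distrib)

fun extremal :: "nat \<Rightarrow> verma" where
  "extremal 0 = verma_vac"
| "extremal (Suc j) = ea (- (2 * int j + 1)) (extremal j)"

lemma extremal_W_N: "extremal j \<in> W_N"
  by (induction j) (simp_all add: W_N_vac W_N_ea)

lemma ha_0_extremal: "ha 0 (extremal j) = verma_scale (of_nat (2 * j)) (extremal j)"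
  by (induction j) (simp_all add: verma_act_mode_vac ha_ea vm.act_scale_right vm.scale_left_distrib)

text \<open>A nonempty list with \<open>diff_two j\<close> also keeps distance 2 from the indices \<open>2j-1, \<dots>, 3, 1\<close> of \<open>extremal j\<close>.\<close>

definition diff_two :: "nat \<Rightarrow> int list \<Rightarrow> bool"
  where "diff_two j l \<longleftrightarrow> successively (\<lambda>a b. a \<ge> b + 2) l \<and> (l \<noteq> [] \<longrightarrow> last l \<ge> 2 * int j + 1)"

text \<open>The interface between vertex algebra and combinatorics: \<open>I\<close> will be the
  ideal of \<open>W_N\<close> and \<open>K\<close> the kernel. The quadratic sums are the modes of
  index \<open>- n\<close> of \<open>x_alpha_squared_vac\<close> on \<open>W_N\<close>.\<close>

locale relation_ideal =
  fixes I K :: "verma set"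
  assumes subspace_I: "vm.subspace I" and submodule_K: "vm.submodule K" and I_le_K: "I \<subseteq> K"
    and vac_notin_K: "verma_vac \<notin> K"
    and I_ea: "v \<in> I \<Longrightarrow> ea m v \<in> I"
    and quadratic_relation: "w \<in> W_N \<Longrightarrow> (\<Sum>i<n. ea (- 1 - int i) (ea (int i - int n) w)) \<in> I"
begin

lemma subspace_K: "vm.subspace K"
  using submodule_K by (simp add: vm.submodule_def)

lemma monomial_I: "v \<in> I \<Longrightarrow> monomial l v \<in> I"
  by (induction l) (simp_all add: I_ea)

text \<open>
  In the relation \<open>\<Sum>\<^bsub>i+j=a+b\<^esub> x(-i) x(-j) w \<in> I\<close> the pair \<open>(a, b)\<close> has the least spread, so its term
  is determined by those of greater spread.
\<close>

lemma adjacent_relation: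
  assumes w: "w \<in> W_N" and S: "vm.subspace S" "I \<subseteq> S" and b: "b \<ge> 1" and a: "a = b \<or> a = b + 1"
    and spread: "\<And>j. 1 \<le> j \<Longrightarrow> j < b \<Longrightarrow> ea (- (a + j)) (ea (- (b - j)) w) \<in> S"
  shows "ea (- a) (ea (- b) w) \<in> S"
proof -
  \<comment> \<open>The pairs \<open>(1 + i, n - i)\<close> with \<open>i < n\<close> are the
    splittings of \<open>a + b\<close> into positive parts. \<open>M\<close> collects those equal to
    \<open>(a, b)\<close> or \<open>(b, a)\<close>, so the wanted term occurs once or twice.\<close>
  define n where "n = nat (a + b - 1)"
  have n: "int n = a + b - 1" using a b by (auto simp: n_def)
  define f where "f i = ea (- 1 - int i) (ea (int i - int n) w)" for i
  define M where "M = {nat (b - 1)..nat (a - 1)}"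
  have "f i \<in> S" if i: "i \<in> {..<n} - M" for i
  proof (cases "int i \<ge> a")
    case True
    define j where "j = 1 + int i - a"
    have eqs: "- 1 - int i = - (a + j)" "int i - int n = - (b - j)"
      using n by (simp_all add: j_def)
    show ?thesis unfolding f_def eqs by (rule spread) (use True i n in \<open>auto simp: j_def\<close>)
  next
    case False
    then have i': "int i < b - 1" using i a b by (auto simp: M_def nat_le_iff le_nat_iff)
    define j where "j = b - 1 - int i"
    have eqs: "- 1 - int i = - (b - j)" "int i - int n = - (a + j)"
      using n by (simp_all add: j_def)
    show ?thesis
      unfolding f_def eqs ea_commute[of "- (b - j)"] by (rule spread) (use i' in \<open>auto simp: j_def\<close>)
  qed
  then have "sum f ({..<n} - M) \<in> S" by (rule vm.subspace_sum[OF S(1)])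
  moreover have "sum f {..<n} \<in> S"
    using quadratic_relation[OF w, of n] S(2) by (auto simp: f_def)
  moreover have "M \<subseteq> {..<n}" using a b n by (auto simp: M_def)
  ultimately have M: "sum f M \<in> S"
    using vm.subspace_diff[OF S(1)] by (metis double_diff finite_lessThan order_refl sum_diff Diff_subset)
  show ?thesis
  proof (cases "a = b")
    case True
    then have "M = {nat (b - 1)}" by (auto simp: M_def)
    then show ?thesis using M b n True by (simp add: f_def)
  next
    case False
    have eqs: "- 1 - int (nat (b - 1)) = - b" "int (nat (b - 1)) - int n = - a"
        "- 1 - int (nat b) = - a" "int (nat b) - int n = - b"
      using False a b n by auto
    have "M = {nat (b - 1), nat b}" using False a b by (auto simp: M_def)
    moreover have "nat (b - 1) \<noteq> nat b" using b by simp
    moreover have "f (nat b) = ea (- a) (ea (- b) w)"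
      unfolding f_def eqs ..
    moreover have "f (nat (b - 1)) = ea (- a) (ea (- b) w)"
      unfolding f_def eqs by (rule ea_commute)
    ultimately have "verma_scale 2 (ea (- a) (ea (- b) w)) \<in> S"
      using M by (simp add: verma_scale_two)
    from vm.subspace_scale[OF S(1) this, of "1 / 2"] show ?thesis by simp
  qed
qed

text \<open>In the step to \<open>Suc j\<close>, the new indices \<open>2j+1\<close> and
  \<open>2j+2\<close> form an adjacent pair with the leading factor. Every wider pair contains an
  index at most \<open>2j\<close> and lies in \<open>I\<close> by induction.\<close>

lemma ea_extremal: "m \<le> 2 * int j \<Longrightarrow> ea (- m) (extremal j) \<in> I"
proof (induction j arbitrary: m)
  case 0
  then show ?case by (simp add: verma_act_mode_vac vm.subspace_0[OF subspace_I])
next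
  case (Suc j)
  have *: "ea (- (a + i)) (ea (- (2 * int j + 1 - i)) (extremal j)) \<in> I" if "1 \<le> i" for a i
    using that by (intro I_ea Suc.IH) simp
  have "m \<le> 2 * int j \<or> m = 2 * int j + 1 \<or> m = 2 * int j + 1 + 1"
    using Suc.prems by auto
  then consider "m \<le> 2 * int j" | "m = 2 * int j + 1" | "m = 2 * int j + 1 + 1"
    by blast
  then show ?case
  proof cases
    case 1
    then show ?thesis
      unfolding extremal.simps ea_commute[of "- m"] by (intro I_ea Suc.IH)
  next
    case 2
    then show ?thesis
      unfolding extremal.simps
      by (simp only:) (rule adjacent_relation[OF extremal_W_N subspace_I order_refl _ _ *]; simp)
  next
    case 3
    then show ?thesis
      unfolding extremal.simps
      by (simp only:) (rule adjacent_relation[OF extremal_W_N subspace_I order_refl _ _ *]; simp)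
  qed
qed

text \<open>Lowering the leading index \<open>2j+1\<close> by \<open>n\<close> puts an index at most
  \<open>2j\<close> on \<open>extremal j\<close>.\<close>

lemma ha_extremal: "n > 0 \<Longrightarrow> ha n (extremal j) \<in> I"
proof (induction j)
  case 0
  then show ?case by (simp add: verma_act_mode_vac vm.subspace_0[OF subspace_I])
next
  case (Suc j)
  have "ea (- (2 * int j + 1 - n)) (extremal j) \<in> I"
    using Suc by (intro ea_extremal) simp
  then have "ea (n + - (2 * int j + 1)) (extremal j) \<in> I"
    by (simp add: algebra_simps)
  then show ?case
    unfolding extremal.simps ha_ea
    by (rule vm.subspace_add[OF subspace_I I_ea[OF Suc.IH[OF Suc.prems]] vm.subspace_scale[OF subspace_I]])
qed

lemma fa_extremal: "m \<ge> 2 * int j + 1 \<Longrightarrow> fa m (extremal j) \<in> I"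
proof (induction j)
  case 0
  then show ?case by (simp add: verma_act_mode_vac vm.subspace_0[OF subspace_I])
next
  case (Suc j)
  then have "ha (m + - (2 * int j + 1)) (extremal j) \<in> I"
    by (intro ha_extremal) simp
  then show ?case
    using Suc unfolding extremal.simps fa_ea
    by (intro vm.subspace_add[OF subspace_I] vm.subspace_diff[OF subspace_I] I_ea)
       (auto simp: vm.subspace_0[OF subspace_I])
qed

lemma extremal_notin_K: "extremal j \<notin> K"
proof (induction j)
  case 0
  then show ?case by (simp add: vac_notin_K)
next
  case (Suc j)
  show ?case
  proof
    assume "extremal (Suc j) \<in> K"
    then have "fa (2 * int j + 1) (extremal (Suc j)) \<in> K"
      using submodule_K by (auto simp: vm.submodule_def)
    moreover have "ea (- (2 * int j + 1)) (fa (2 * int j + 1) (extremal j)) \<in> K"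
      using I_le_K I_ea fa_extremal[of j "2 * int j + 1"] by auto
    ultimately have "fa (2 * int j + 1) (extremal (Suc j))
        - ea (- (2 * int j + 1)) (fa (2 * int j + 1) (extremal j)) \<in> K"
      by (rule vm.subspace_diff[OF subspace_K])
    \<comment> \<open>The central term \<open>2j+1\<close> minus the \<open>ha 0\<close>-eigenvalue
      \<open>2j\<close> leaves coefficient 1.\<close>
    also have "fa (2 * int j + 1) (extremal (Suc j))
        - ea (- (2 * int j + 1)) (fa (2 * int j + 1) (extremal j)) = extremal j"
      unfolding extremal.simps fa_ea
      by (simp add: ha_0_extremal vm.scale_left_distrib)
    finally show False using Suc by simp
  qed
qed

lemma elem_op_extremal: "elem_op (Suc s) (extremal j) \<in> I"
proof (induction j arbitrary: s)
  case 0
  then show ?case by (simp add: elem_op_Suc_vac vm.subspace_0[OF subspace_I])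
next
  case (Suc j)
  have "ea (- (2 * int j)) (elem_op s (extremal j)) \<in> I"
    using Suc by (cases s) (simp_all add: ea_extremal I_ea)
  then have "ea (- (2 * int j + 1) + 1) (elem_op s (extremal j)) \<in> I" by simp
  then show ?case
    unfolding extremal.simps elem_op_Suc_ea
    by (rule vm.subspace_add[OF subspace_I I_ea[OF Suc.IH]])
qed

text \<open>Modulo \<open>I\<close> only the factors of \<open>l\<close> can be shifted, each at
  most once; in degree \<open>length l\<close> all of them must be.\<close>

lemma elem_op_monomial_extremal:
  shows "r > length l \<Longrightarrow> elem_op r (monomial l (extremal j)) \<in> I"
    and "elem_op (length l) (monomial l (extremal j)) - monomial (map (\<lambda>m. m - 1) l) (extremal j) \<in> I"
proof (induction l arbitrary: r)
  case Nil
  {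
    case 1
    then show ?case by (cases r) (simp_all add: elem_op_extremal)
  next
    case 2
    then show ?case by (simp add: vm.subspace_0[OF subspace_I])
  }
next
  case (Cons m l)
  {
    case 1
    then obtain s where "r = Suc s" "s > length l" by (cases r) auto
    then show ?case
      by (simp add: elem_op_Suc_ea vm.subspace_add[OF subspace_I] I_ea Cons.IH)
  next
    case 2
    have *: "ea (- m + 1) (elem_op (length l) (monomial l (extremal j)))
        - ea (- m + 1) (monomial (map (\<lambda>m. m - 1) l) (extremal j)) \<in> I"
      using I_ea[OF Cons.IH(2)] by (simp only: vm.act_minus_right)
    have "ea (- m) (elem_op (Suc (length l)) (monomial l (extremal j)))
        + (ea (- m + 1) (elem_op (length l) (monomial l (extremal j)))
        - ea (- m + 1) (monomial (map (\<lambda>m. m - 1) l) (extremal j))) \<in> I"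
      by (intro vm.subspace_add[OF subspace_I] * I_ea Cons.IH) simp
    then show ?case
      by (simp add: elem_op_Suc_ea algebra_simps)
  }
qed

text \<open>Each application of \<open>elem_op n\<close> preserves \<open>K\<close> and, modulo
  \<open>I\<close>, lowers every entry of \<open>l\<close> by one.\<close>

lemma shift_monomials:
  assumes "\<And>l. l \<in> A \<Longrightarrow> length l = n" and "(\<Sum>l\<in>A. verma_scale (c l) (monomial l (extremal j))) \<in> K"
  shows "(\<Sum>l\<in>A. verma_scale (c l) (monomial (map (\<lambda>m. m - int d) l) (extremal j))) \<in> K"
proof (induction d)
  case 0
  then show ?case using assms(2) by simp
next
  case (Suc d)
  let ?p = "\<lambda>d. \<Sum>l\<in>A. verma_scale (c l) (monomial (map (\<lambda>m. m - int d) l) (extremal j))"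
  have "elem_op n (monomial (map (\<lambda>m. m - int d) l) (extremal j))
      - monomial (map (\<lambda>m. m - int (Suc d)) l) (extremal j) \<in> I" if "l \<in> A" for l
    using elem_op_monomial_extremal(2)[of "map (\<lambda>m. m - int d) l" j] assms(1)[OF that]
    by (simp add: comp_def algebra_simps)
  then have "(\<Sum>l\<in>A. verma_scale (c l) (elem_op n (monomial (map (\<lambda>m. m - int d) l) (extremal j))
      - monomial (map (\<lambda>m. m - int (Suc d)) l) (extremal j))) \<in> I"
    by (intro vm.subspace_sum[OF subspace_I] vm.subspace_scale[OF subspace_I])
  then have "elem_op n (?p d) - ?p (Suc d) \<in> I"
    by (simp only: elem_op_sum elem_op_scale vm.scale_right_diff_distrib sum_subtractf)
  then have "elem_op n (?p d) - (elem_op n (?p d) - ?p (Suc d)) \<in> K"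
    by (rule vm.subspace_diff[OF subspace_K elem_op_submodule[OF submodule_K Suc.IH] subsetD[OF I_le_K]])
  then show ?case by simp
qed

end


section \<open>Difference-two monomials\<close>

text \<open>The entry before \<open>M\<close> is at least \<open>M + 2\<close>, which the shift by
  \<open>d\<close> turns into \<open>2j+3\<close>, the bound for \<open>Suc j\<close>.\<close>

lemma diff_two_snoc: "diff_two j (l @ [M]) \<Longrightarrow> M = 2 * int j + 1 + int d \<Longrightarrow>
    diff_two (Suc j) (map (\<lambda>m. m - int d) l)"
  by (auto simp: diff_two_def successively_append_iff successively_map last_map)

context relation_ideal
begin

text \<open>
  The operator \<open>E\<^sub>n\<close> lowers all \<open>n\<close> indices by one, and a monomial whose last index falls to \<open>2j\<close> lies in \<open>I\<close>.
  So a suitable power of \<open>E\<^sub>n\<close> leaves exactly the monomials with the largest last index, now equal to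
  \<open>2j+1\<close>, and this index is absorbed into \<open>extremal (Suc j)\<close>.
\<close>

lemma diff_two_independent:
  assumes "finite A" and "\<And>l. l \<in> A \<Longrightarrow> length l = n \<and> diff_two j l"
    and "(\<Sum>l\<in>A. verma_scale (c l) (monomial l (extremal j))) \<in> K"
  shows "\<forall>l\<in>A. c l = 0"
  using assms
proof (induction n arbitrary: j A c)
  case 0
  show ?case
  proof (cases "A = {}")
    case False
    with 0 have "A = {[]}" by auto
    with 0 have K: "verma_scale (c []) (extremal j) \<in> K" by simp
    have "c [] = 0"
    proof (rule ccontr)
      assume "c [] \<noteq> 0"
      with vm.subspace_scale[OF subspace_K K, of "inverse (c [])"] show False
        by (simp add: extremal_notin_K)
    qed
    then show ?thesis by (simp add: \<open>A = {[]}\<close>)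
  qed simp
next
  case (Suc n)
  define B where "B = {l \<in> A. c l \<noteq> 0}"
  show ?case
  proof (rule ccontr)
    assume "\<not> ?thesis"
    then have "B \<noteq> {}" by (auto simp: B_def)
    have B: "finite B" "\<And>l. l \<in> B \<Longrightarrow> length l = Suc n \<and> diff_two j l"
      using Suc.prems by (auto simp: B_def)
    have sum_B: "(\<Sum>l\<in>B. verma_scale (c l) (monomial l (extremal j))) \<in> K"
      using Suc.prems(3) unfolding B_def
      by (subst sum.mono_neutral_left[OF Suc.prems(1)]) auto
    define M where "M = Max (last ` B)"
    have M_max: "last l \<le> M" if "l \<in> B" for l
      using B(1) that by (simp add: M_def)
    have "M \<in> last ` B"
      using B(1) \<open>B \<noteq> {}\<close> by (simp add: M_def)
    then obtain l\<^sub>0 where l\<^sub>0: "l\<^sub>0 \<in> B" "last l\<^sub>0 = M" by auto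
    then have "M \<ge> 2 * int j + 1" using B(2)[of l\<^sub>0] by (auto simp: diff_two_def)
    then obtain d where d: "M = 2 * int j + 1 + int d" using zle_iff_zadd by auto
    define C where "C = {l \<in> B. last l = M}"
    \<comment> \<open>The last entry is dropped because after the shift it equals
      \<open>2j+1\<close> on \<open>C\<close> and merges into
      \<open>extremal (Suc j)\<close>.\<close>
    define \<phi> where "\<phi> l = map (\<lambda>m. m - int d) (butlast l)" for l
    define t where "t l = verma_scale (c l) (monomial (map (\<lambda>m. m - int d) l) (extremal j))" for l
    have snoc: "l = butlast l @ [last l]" if "l \<in> B" for l
      using B(2)[OF that] by (cases l) auto
    have shifted: "monomial (map (\<lambda>m. m - int d) l) (extremal j)
        = monomial (\<phi> l) (ea (- (last l - int d)) (extremal j))" if "l \<in> B" for l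
      by (subst snoc[OF that]) (simp add: \<phi>_def)
    have "t l \<in> K" if "l \<in> B - C" for l
    proof -
      have "last l < M" using that M_max[of l] by (auto simp: C_def)
      then have "monomial (\<phi> l) (ea (- (last l - int d)) (extremal j)) \<in> I"
        using d by (intro monomial_I ea_extremal) simp
      then show ?thesis
        using that I_le_K by (auto simp: t_def shifted intro: vm.subspace_scale[OF subspace_K])
    qed
    then have "sum t (B - C) \<in> K" by (rule vm.subspace_sum[OF subspace_K])
    moreover have "sum t B \<in> K"
      unfolding t_def by (rule shift_monomials[OF _ sum_B]) (use B(2) in auto)
    moreover have "sum t B = sum t (B - C) + sum t C"
      using B(1) by (intro sum.subset_diff) (auto simp: C_def)
    ultimately have C_K: "sum t C \<in> K"
      using vm.subspace_diff[OF subspace_K, of "sum t B" "sum t (B - C)"] by simp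
    have inj: "inj_on \<phi> C"
    proof (rule inj_onI)
      fix k l
      assume kl: "k \<in> C" "l \<in> C" "\<phi> k = \<phi> l"
      have "inj (\<lambda>m. m - int d)" by (simp add: inj_def)
      then have "butlast k = butlast l"
        using kl(3) unfolding \<phi>_def by (simp add: inj_map_eq_map)
      moreover have "k \<in> B" "l \<in> B" "last k = last l" using kl by (auto simp: C_def)
      ultimately show "k = l" using snoc by metis
    qed
    define c' where "c' l = c (inv_into C \<phi> l)" for l
    have "t l = verma_scale (c' (\<phi> l)) (monomial (\<phi> l) (extremal (Suc j)))" if "l \<in> C" for l
    proof -
      have eq: "- (last l - int d) = - (2 * int j + 1)" and "l \<in> B"
        using that d by (simp_all add: C_def)
      show ?thesis
        unfolding t_def c'_def inv_into_f_f[OF inj that] shifted[OF \<open>l \<in> B\<close>] eq extremal.simps ..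
    qed
    then have "sum t C = (\<Sum>l\<in>\<phi> ` C. verma_scale (c' l) (monomial l (extremal (Suc j))))"
      by (simp add: sum.reindex[OF inj])
    with C_K have "\<forall>l\<in>\<phi> ` C. c' l = 0"
    proof (intro Suc.IH)
      show "length l = n \<and> diff_two (Suc j) l" if l: "l \<in> \<phi> ` C" for l
      proof -
        obtain k where "k \<in> C" and "l = \<phi> k" using l by blast
        then have k: "k \<in> B" "last k = M" "l = \<phi> k" by (simp_all add: C_def)
        then have "diff_two j (butlast k @ [M])" using B(2)[of k] snoc[of k] by metis
        from diff_two_snoc[OF this d] show ?thesis
          using k B(2)[of k] by (simp add: \<phi>_def)
      qed
    qed (use B(1) in \<open>auto simp: C_def\<close>)
    then have "c l\<^sub>0 = 0"
      using l\<^sub>0 inv_into_f_f[OF inj, of l\<^sub>0] by (auto simp: c'_def C_def)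
    with l\<^sub>0 show False by (simp add: B_def)
  qed
qed

section \<open>Straightening and the intersection with the kernel\<close>

lemma not_successively_split:
  "\<not> successively P l \<Longrightarrow> \<exists>xs a b ys. l = xs @ a # b # ys \<and> \<not> P a b"
proof (induction l rule: induct_list012)
  case (3 x y zs)
  show ?case
  proof (cases "P x y")
    case True
    with 3 obtain xs a b ys where "y # zs = xs @ a # b # ys" "\<not> P a b" by auto
    then have "x # y # zs = (x # xs) @ a # b # ys" "\<not> P a b" by auto
    then show ?thesis by blast
  qed (metis append_Nil)
qed auto

lemma sum_squares_le:
  fixes l :: "int list"
  assumes "\<forall>m\<in>set l. m \<ge> 0"
  shows "(\<Sum>m\<leftarrow>l. m\<^sup>2) \<le> (sum_list l)\<^sup>2"
  using assms
proof (induction l)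
  case (Cons m l)
  have "sum_list l \<ge> 0" using Cons.prems by (intro sum_list_nonneg) auto
  then have "0 \<le> m * sum_list l" using Cons.prems by simp
  then show ?case using Cons by (simp add: power2_sum)
qed simp

text \<open>Spreading two indices raises the sum of squares, which is bounded by the square of the sum.\<close>

lemma straighten:
  assumes "\<forall>m\<in>set l. m \<ge> 1"
  shows "monomial l verma_vac \<in> vm.span ((\<lambda>l. monomial l verma_vac) ` {l. diff_two 0 l} \<union> I)"
    (is "_ \<in> ?D")
  using assms
proof (induction l rule: measure_induct_rule[of "\<lambda>l. nat ((sum_list l)\<^sup>2 - (\<Sum>m\<leftarrow>l. m\<^sup>2))"])
  case (less l)
  \<comment> \<open>Factors commute, so the list may be sorted; then a violation of the difference
    condition is a pair of equal or consecutive neighbours.\<close>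
  define s where "s = rev (sort l)"
  have mset: "mset s = mset l" and set: "set s = set l" by (simp_all add: s_def)
  have sorted: "sorted_wrt (\<ge>) s" by (simp add: s_def sorted_wrt_rev)
  have sums: "sum_list s = sum_list l" "(\<Sum>m\<leftarrow>s. m\<^sup>2) = (\<Sum>m\<leftarrow>l. m\<^sup>2)"
    using mset by (metis mset_map sum_mset_sum_list)+
  have "monomial s verma_vac \<in> ?D"
  proof (cases "successively (\<lambda>a b. a \<ge> b + 2) s")
    case True
    then have "diff_two 0 s"
      using less.prems set by (auto simp: diff_two_def)
    then show ?thesis by (intro vm.span_base) auto
  next
    case False
    then obtain xs a b ys where s: "s = xs @ a # b # ys" and ab: "\<not> a \<ge> b + 2"
      using not_successively_split[OF False] by auto
    have "a \<ge> b" using sorted by (simp add: s sorted_wrt_append)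
    have pos: "m \<ge> 1" if "m \<in> set s" for m
      using that less.prems set by auto
    \<comment> \<open>This subspace lets the relation be applied behind the prefix
      \<open>xs\<close>.\<close>
    let ?S = "{v. monomial xs v \<in> ?D}"
    have "ea (- a) (ea (- b) (monomial ys verma_vac)) \<in> ?S"
    proof (rule adjacent_relation)
      show "monomial ys verma_vac \<in> W_N" by (simp add: monomial_W_N W_N_vac)
      show "vm.subspace ?S"
        by (intro vm.subspaceI)
           (auto simp: monomial_add monomial_scale monomial_zero vm.span_zero vm.span_add vm.span_scale)
      show "I \<subseteq> ?S" by (auto intro!: vm.span_base monomial_I)
      show "b \<ge> 1" using pos by (simp add: s)
      show "a = b \<or> a = b + 1" using ab \<open>a \<ge> b\<close> by auto
      fix j :: int
      assume j: "1 \<le> j" "j < b"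
      let ?l = "xs @ (a + j) # (b - j) # ys"
      have pos': "\<forall>m\<in>set ?l. m \<ge> 1"
        using pos j \<open>a \<ge> b\<close> by (auto simp: s)
      have "j * (a - b) \<ge> 0" "j\<^sup>2 \<ge> 1"
        using j \<open>a \<ge> b\<close> by (simp_all add: one_le_power)
      then have "(a + j)\<^sup>2 + (b - j)\<^sup>2 > a\<^sup>2 + b\<^sup>2"
        by (simp add: power2_eq_square algebra_simps)
      then have "(\<Sum>m\<leftarrow>l. m\<^sup>2) < (\<Sum>m\<leftarrow>?l. m\<^sup>2)"
        unfolding sums(2)[symmetric] s by simp
      moreover have "sum_list ?l = sum_list l"
        unfolding sums(1)[symmetric] s by simp
      moreover have "\<forall>m\<in>set ?l. m \<ge> 0" using pos' by force
      then have "(\<Sum>m\<leftarrow>?l. m\<^sup>2) \<le> (sum_list ?l)\<^sup>2" by (rule sum_squares_le)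
      ultimately have "monomial ?l verma_vac \<in> ?D"
        by (intro less.IH pos') simp
      then show "ea (- (a + j)) (ea (- (b - j)) (monomial ys verma_vac)) \<in> ?S" by simp
    qed
    then show ?thesis by (simp add: s)
  qed
  then show ?case using monomial_permute[OF mset] by simp
qed

lemma W_N_le_span_diff_two:
  "W_N \<subseteq> vm.span ((\<lambda>l. monomial l verma_vac) ` {l. diff_two 0 l} \<union> I)" (is "_ \<subseteq> ?D")
  unfolding W_N_eq_span
proof (intro vm.span_minimal image_subsetI)
  fix l :: "int list"
  have l: "foldr (\<lambda>m. ea m) l verma_vac = monomial (map uminus l) verma_vac"
    by (simp add: monomial_def foldr_map comp_def)
  show "foldr (\<lambda>m. ea m) l verma_vac \<in> ?D"
  proof (cases "\<forall>m\<in>set (map uminus l). m \<ge> 1")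
    case True
    then show ?thesis unfolding l by (rule straighten)
  next
    case False
    then obtain m where "m \<in> set (map uminus l)" "m \<le> 0" by force
    then obtain xs ys where "map uminus l = xs @ m # ys" by (meson split_list)
    moreover have "ea (- m) (monomial ys verma_vac) = 0"
      using \<open>m \<le> 0\<close> by (intro ea_nonneg_W_N monomial_W_N W_N_vac) simp
    ultimately show ?thesis by (simp add: l monomial_zero vm.span_zero)
  qed
qed simp

text \<open>Modulo \<open>I\<close>, an element becomes a combination of difference-two monomials
  lying in \<open>K\<close>. The eigenvalues of \<open>ha 0\<close> separate it by length, and
  independence kills every coefficient.\<close>

lemma W_N_Int_K: "W_N \<inter> K \<subseteq> I"
proof
  fix w
  assume w: "w \<in> W_N \<inter> K"
  let ?X = "\<lambda>l. monomial l verma_vac"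
  have "\<exists>A c i. finite A \<and> A \<subseteq> {l. diff_two 0 l} \<and> i \<in> I \<and> w = (\<Sum>l\<in>A. verma_scale (c l) (?X l)) + i"
  proof -
    obtain x i where "w = x + i" "x \<in> vm.span (?X ` {l. diff_two 0 l})" "i \<in> vm.span I"
      using w W_N_le_span_diff_two unfolding vm.span_Un by auto
    moreover have "vm.span I = I" using subspace_I by (simp add: vm.span_eq_iff)
    moreover obtain t r where t: "finite t" "t \<subseteq> ?X ` {l. diff_two 0 l}" "x = (\<Sum>a\<in>t. verma_scale (r a) a)"
      using calculation(2) by (auto simp: vm.span_explicit)
    \<comment> \<open>One list is chosen for each vector, so that the sum over vectors becomes a sum
      over lists.\<close>
    moreover obtain A where A: "A \<subseteq> {l. diff_two 0 l}" "inj_on ?X A" "t = ?X ` A"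
      using t(2) by (meson subset_image_inj)
    ultimately show ?thesis
      by (intro exI[of _ A] exI[of _ "\<lambda>l. r (?X l)"] exI[of _ i])
         (simp add: sum.reindex finite_image_iff)
  qed
  then obtain A c i where A: "finite A" "A \<subseteq> {l. diff_two 0 l}" and i: "i \<in> I"
    and w_eq: "w = (\<Sum>l\<in>A. verma_scale (c l) (?X l)) + i" by blast
  define g where "g k = (\<Sum>l\<in>{l \<in> A. length l = k}. verma_scale (c l) (?X l))" for k
  have "w - i \<in> K" using w i I_le_K by (intro vm.subspace_diff[OF subspace_K]) auto
  moreover have "w - i = sum g (length ` A)"
    unfolding g_def w_eq by (simp add: sum.image_gen[OF A(1), of _ length])
  ultimately have sum_K: "sum g (length ` A) \<in> K" by simp
  have "g k \<in> K" if "k \<in> length ` A" for k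
  proof (rule vm.eigenvectors_in_subspace[OF subspace_K _ vm.act_add_right vm.act_scale_right _ _ _ sum_K that])
    show "ha 0 u \<in> K" if "u \<in> K" for u
      using submodule_K that by (auto simp: vm.submodule_def)
    show "inj_on (\<lambda>k. of_nat (2 * k) :: complex) (length ` A)" by (auto simp: inj_on_def)
    show "ha 0 (g k) = verma_scale (of_nat (2 * k)) (g k)" for k
      unfolding g_def vm.scale_sum_right vm.act_sum_right
      by (intro sum.cong refl) (auto simp: vm.act_scale_right ha_0_monomial mult.commute)
  qed (use A(1) in simp)
  then have "\<forall>l\<in>{l \<in> A. length l = k}. c l = 0" if "k \<in> length ` A" for k
    using that A by (intro diff_two_independent[where j = 0 and n = k]) (auto simp: g_def)
  then have "c l = 0" if "l \<in> A" for l using that by blast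
  then have "w = i" by (simp add: w_eq)
  with i show "w \<in> I" by simp
qed

end

section \<open>Quadratic relations as modes, and principal ideals\<close>

context standard_voa
begin

text \<open>In the iterate formula with \<open>l = -1\<close> all coefficients are 1. Nonnegative
  modes vanish on \<open>W_N\<close>, which removes the second products and the terms with
  \<open>i \<ge> n\<close>.\<close>

lemma square_mode:
  assumes "w \<in> W_N"
  shows "Y x_alpha_squared_vac (- int n) w = (\<Sum>i<n. ea (- 1 - int i) (ea (int i - int n) w))"
proof -
  let ?u = "ea (-1) verma_vac"
  let ?f = "\<lambda>i::nat. verma_scale ((-1) ^ i * (of_int (-1) gchoose i))
      (Y ?u (-1 - int i) (Y ?u (- int n + int i) w)
        - verma_scale ((-1) powi (-1)) (Y ?u (- int n + -1 - int i) (Y ?u (int i) w)))"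
  have coeff: "(-1) ^ i * (of_int (-1) gchoose i) = (1 :: complex)" for i
  proof -
    have "(of_int (-1) gchoose i :: complex) = (-1) ^ i"
      using gbinomial_minus[of "1 :: complex" i] binomial_gbinomial[of i i, where 'a = complex] by simp
    then show ?thesis by (simp flip: power_mult_distrib)
  qed
  have f: "?f i = ea (- 1 - int i) (ea (int i - int n) w)" for i
    unfolding coeff Y_generator using assms by (simp add: ea_nonneg_W_N)
  have "?f i = 0" if "i \<notin> {..<n}" for i
    unfolding f using that assms by (simp add: ea_nonneg_W_N)
  then have "Sum_any ?f = sum ?f {..<n}"
    by (intro Sum_any.expand_superset) blast+
  also have "\<dots> = (\<Sum>i<n. ea (- 1 - int i) (ea (int i - int n) w))"
    by (intro sum.cong refl f)
  finally show ?thesis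
    using iterate_formula[of ?u "-1" ?u "- int n" w]
    by (simp only: x_alpha_squared_vac_def Y_generator)
qed

lemma principal_ideal_least: "va_ideal V I \<Longrightarrow> v \<in> I \<Longrightarrow> principal_ideal V v \<subseteq> I"
  by (auto simp: principal_ideal_def)

text \<open>The first assumption puts \<open>V\<close> itself into the intersected family, so that
  the intersection stays inside \<open>V\<close>.\<close>

lemma va_ideal_principal_ideal:
  assumes "va_ideal V V" "v \<in> V"
  shows "va_ideal V (principal_ideal V v)" "v \<in> principal_ideal V v"
  using assms unfolding principal_ideal_def va_ideal_def
  by (auto intro!: subspace_Inter)

lemma va_ideal_W_N: "va_ideal W_N W_N"
  using W_N_subalgebra by (auto simp: va_ideal_def vertex_subalgebra_def)

lemma va_ideal_Int_W_N: "va_ideal UNIV I \<Longrightarrow> va_ideal W_N (I \<inter> W_N)"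
  using W_N_subalgebra by (auto simp: va_ideal_def vertex_subalgebra_def intro: subspace_inter)

lemma x_alpha_squared_W_N: "x_alpha_squared_vac \<in> W_N"
  by (simp add: x_alpha_squared_vac_def W_N_ea W_N_vac)

end

theorem theorem4p1:
  fixes Y :: "verma \<Rightarrow> int \<Rightarrow> verma \<Rightarrow> verma"
    and scaleL :: "complex \<Rightarrow> 'l \<Rightarrow> 'l::ab_group_add"
    and actL :: "affine \<Rightarrow> 'l \<Rightarrow> 'l"
    and vL :: 'l
    and proj :: "verma \<Rightarrow> 'l"
  assumes "standard_voa_structure Y"
    and "standard_module_\<Lambda>0 scaleL actL vL"
    and "lie_module_hom verma_scale verma_act scaleL actL proj"
    and "proj verma_vac = vL"
  shows "vertex_algebra.vertex_subalgebra verma_scale Y verma_vac W_N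
    \<and> {w \<in> W_N. proj w = 0}
        = vertex_algebra.principal_ideal verma_scale Y UNIV x_alpha_squared_vac \<inter> W_N
    \<and> vertex_algebra.principal_ideal verma_scale Y UNIV x_alpha_squared_vac \<inter> W_N
        = vertex_algebra.principal_ideal verma_scale Y W_N x_alpha_squared_vac"
proof -
  interpret standard_voa Y
    using assms(1) unfolding standard_voa_structure_def standard_voa_def standard_voa_axioms_def .
  let ?K = "{v. proj v = 0}"
  let ?J = "principal_ideal UNIV x_alpha_squared_vac"
  let ?I = "principal_ideal W_N x_alpha_squared_vac"
  note K = x_alpha_squared_in_kernel[OF assms(2,3,4)]
  have I: "va_ideal W_N ?I" "x_alpha_squared_vac \<in> ?I"
    using va_ideal_principal_ideal[OF va_ideal_W_N x_alpha_squared_W_N] .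
  have "va_ideal UNIV UNIV" by (simp add: va_ideal_def)
  then have "va_ideal UNIV ?J" "x_alpha_squared_vac \<in> ?J"
    by (simp_all only: va_ideal_principal_ideal UNIV_I)
  then have IJ: "?I \<subseteq> ?J \<inter> W_N"
    by (intro principal_ideal_least va_ideal_Int_W_N) (simp_all add: x_alpha_squared_W_N)
  have JK: "?J \<subseteq> ?K"
    using K by (intro principal_ideal_least submodule_va_ideal) auto
  \<comment> \<open>The inclusions from \<open>?I\<close> up to the kernel are settled; this
    instance supplies the return inclusion that closes the chain.\<close>
  interpret relation_ideal ?I ?K
  proof
    show "vm.subspace ?I" using I(1) by (simp add: va_ideal_def)
    show "vm.submodule ?K" by (fact K(1))
    show "?I \<subseteq> ?K" using IJ JK by auto
    show "verma_vac \<notin> ?K"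
      using assms(2,4) by (simp add: standard_module_\<Lambda>0_def highest_weight_module_\<Lambda>0_def)
    show "ea m v \<in> ?I" if "v \<in> ?I" for m v
    proof -
      have "Y (ea (-1) verma_vac) m v \<in> ?I"
        using I(1) that W_N_ea[OF W_N_vac] by (simp add: va_ideal_def)
      then show ?thesis by (simp add: Y_generator)
    qed
    show "(\<Sum>i<n. ea (- 1 - int i) (ea (int i - int n) w)) \<in> ?I" if "w \<in> W_N" for n w
      unfolding square_mode[OF that, symmetric]
      using I that unfolding va_ideal_def by blast
  qed
  have "W_N \<inter> ?K \<subseteq> ?I" by (rule W_N_Int_K)
  with IJ JK show ?thesis using W_N_subalgebra by auto
qed

end
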